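(* Let $s=\frac n2+\gamma$ for some $\gamma\in(\frac n2,\frac n2+1]$. Suppose $v_s$ is a positive solution of $-\Delta_+v_s-s(n-s)v_s=0$ on $\mathbb R^{n+1}_+$. Define $w_s=1-\frac{v_s}{y^{n-s}}$, $\rho_s=v_s^{1/(n-s)}$ and $g_s^*=\rho_s^2g_+$. Assume: (1) $w_s\in\tilde H^{1,0}(\mathbb R^{n+1}_+)$; (2) the scalar curvature $R_s^*$ of $g_s^*$ is non-negative. Then $v_s=y^{n-s}$, or equivalently, $g_s^*\equiv|dz|^2$.
   Context: $\mathbb R^{n+1}_+=\{z=(x,y):x\in\mathbb R^n,\ y>0\}$, $\mathbb R^n$ is identified with $\{y=0\}$, $g_+=y^{-2}|dz|^2$ is the hyperbolic metric and $\Delta_+$ its Laplace–Beltrami operator (so $-\Delta_+\ge0$). $B_r^+=\{z\in\mathbb R^{n+1}_+:|z|<r\}$. $\tilde H^{1,0}(\mathbb R^{n+1}_+)$ is the set of $u\in W^{1,1}_{\mathrm{loc}}(\mathbb R^{n+1}_+)$ such that for every $r>0$: $\int_{B_r^+}(|\nabla u|^2+u^2)\,dz<\infty$, and there is a sequence $\phi_k\in C^1_c(\overline{B_r^+}\setminus\mathbb R^n)$ with $\int_{B_r^+}(|\nabla(u-\phi_k)|^2+|u-\phi_k|^2)\,dz\to0$. *)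

theory Defs
  imports "HOL-Analysis.Analysis"
begin

section \<open>Differential calculus on open subsets of Euclidean space\<close>

definition pd :: "'m \<Rightarrow> (real^'m::finite \<Rightarrow> real) \<Rightarrow> real^'m \<Rightarrow> real" where
  "pd i f z = frechet_derivative f (at z) (axis i 1)"

definition grad :: "(real^'m::finite \<Rightarrow> real) \<Rightarrow> real^'m \<Rightarrow> real^'m" where
  "grad f z = (\<chi> i. pd i f z)"

text \<open>The next two notions are meant for open sets only.\<close>

definition C1_on :: "(real^'m::finite) set \<Rightarrow> (real^'m \<Rightarrow> real) \<Rightarrow> bool" where
  "C1_on V f \<longleftrightarrow> f differentiable_on V \<and> (\<forall>i. continuous_on V (pd i f))"

definition C2_on :: "(real^'m::finite) set \<Rightarrow> (real^'m \<Rightarrow> real) \<Rightarrow> bool" where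
  "C2_on V f \<longleftrightarrow> C1_on V f \<and> (\<forall>i. C1_on V (pd i f))"

text \<open>
  \<open>C1c S f\<close> says that the restriction of \<open>f\<close> to \<open>S\<close> belongs to $C^1_c(S)$.  The set \<open>S\<close> need
  not be open: $C^1$ on \<open>S\<close> means $C^1$ on an open neighbourhood of \<open>S\<close>, and the support is a
  compact subset of \<open>S\<close>, so that \<open>f\<close> need not vanish at points of the frontier lying in \<open>S\<close>.
\<close>

definition C1c :: "(real^'m::finite) set \<Rightarrow> (real^'m \<Rightarrow> real) \<Rightarrow> bool" where
  "C1c S f \<longleftrightarrow>
     (\<exists>V. open V \<and> S \<subseteq> V \<and> C1_on V f) \<and>
     compact (closure {z \<in> S. f z \<noteq> 0}) \<and> closure {z \<in> S. f z \<noteq> 0} \<subseteq> S"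


section \<open>Riemannian metrics in one coordinate chart\<close>

text \<open>
  A metric on an open subset of $\mathbb{R}^m$ is given by its matrix $(g_{ij})$ in the standard
  coordinates.
\<close>

type_synonym 'm metric = "real^'m \<Rightarrow> real^'m^'m"

text \<open>$\Delta_g u = (\det g)^{-1/2}\, \partial_i \bigl((\det g)^{1/2} g^{ij} \partial_j u\bigr)$\<close>

definition laplace_beltrami :: "'m::finite metric \<Rightarrow> (real^'m \<Rightarrow> real) \<Rightarrow> real^'m \<Rightarrow> real" where
  "laplace_beltrami g u z =
     (1 / sqrt (det (g z))) *
     (\<Sum>i\<in>UNIV. pd i (\<lambda>p. sqrt (det (g p)) * (\<Sum>j\<in>UNIV. matrix_inv (g p) $ i $ j * pd j u p)) z)"

text \<open>\<open>christoffel g k i j\<close> is $\Gamma^k_{ij}$.\<close>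

definition christoffel :: "'m::finite metric \<Rightarrow> 'm \<Rightarrow> 'm \<Rightarrow> 'm \<Rightarrow> real^'m \<Rightarrow> real" where
  "christoffel g k i j z =
     (1 / 2) * (\<Sum>l\<in>UNIV. matrix_inv (g z) $ k $ l *
       (pd i (\<lambda>p. g p $ j $ l) z + pd j (\<lambda>p. g p $ i $ l) z - pd l (\<lambda>p. g p $ i $ j) z))"

text \<open>
  \<open>riemann g l k i j\<close> is the component $R^l{}_{kij}$, that is, the \<open>l\<close>-th component of
  $\nabla_i \nabla_j \partial_k - \nabla_j \nabla_i \partial_k$.  With the contraction below, round
  spheres have positive scalar curvature.
\<close>

definition riemann :: "'m::finite metric \<Rightarrow> 'm \<Rightarrow> 'm \<Rightarrow> 'm \<Rightarrow> 'm \<Rightarrow> real^'m \<Rightarrow> real" where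
  "riemann g l k i j z =
     pd i (christoffel g l j k) z - pd j (christoffel g l i k) z +
     (\<Sum>m\<in>UNIV. christoffel g l i m z * christoffel g m j k z
             - christoffel g l j m z * christoffel g m i k z)"

definition ricci :: "'m::finite metric \<Rightarrow> 'm \<Rightarrow> 'm \<Rightarrow> real^'m \<Rightarrow> real" where
  "ricci g k j z = (\<Sum>i\<in>UNIV. riemann g i k i j z)"

definition scalar_curvature :: "'m::finite metric \<Rightarrow> real^'m \<Rightarrow> real" where
  "scalar_curvature g z = (\<Sum>k\<in>UNIV. \<Sum>j\<in>UNIV. matrix_inv (g z) $ k $ j * ricci g k j z)"


section \<open>The upper half-space\<close>

text \<open>
  $\mathbb{R}^{n+1}$ is \<open>real^('n option)\<close> with $n =$ \<open>CARD('n)\<close>: the coordinates \<open>Some i\<close> are those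
  of $x \in \mathbb{R}^n$ and the coordinate \<open>None\<close> is $y$.
\<close>

definition ht :: "real^('n::finite option) \<Rightarrow> real" where
  "ht z = z $ None"

definition half_space :: "(real^('n::finite option)) set" where
  "half_space = {z. ht z > 0}"

definition half_ball :: "real \<Rightarrow> (real^('n::finite option)) set" where
  "half_ball r = {z \<in> half_space. norm z < r}"

definition hyp_metric :: "'n::finite option metric" where
  "hyp_metric z = (1 / (ht z)\<^sup>2) *\<^sub>R mat 1"


section \<open>Weak derivatives and the function space\<close>

text \<open>
  \<open>has_weak_gradient \<Omega> u D\<close>, for open \<open>\<Omega>\<close>, says that \<open>u\<close> is in $W^{1,1}_{\mathrm{loc}}(\Omega)$
  with distributional gradient \<open>D\<close>.  For locally integrable \<open>u\<close> and \<open>D\<close>, testing against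
  $C^1_c(\Omega)$ is the same as testing against $C^\infty_c(\Omega)$, by mollification.
\<close>

definition has_weak_gradient ::
  "(real^'m::finite) set \<Rightarrow> (real^'m \<Rightarrow> real) \<Rightarrow> (real^'m \<Rightarrow> real^'m) \<Rightarrow> bool" where
  "has_weak_gradient \<Omega> u D \<longleftrightarrow>
     (\<forall>K. compact K \<and> K \<subseteq> \<Omega> \<longrightarrow> set_integrable lebesgue K u \<and> set_integrable lebesgue K D) \<and>
     (\<forall>\<phi> i. C1c \<Omega> \<phi> \<longrightarrow>
        (LINT z:\<Omega>|lebesgue. u z * pd i \<phi> z) = - (LINT z:\<Omega>|lebesgue. D z $ i * \<phi> z))"

text \<open>The space $\tilde H^{1,0}(\mathbb{R}^{n+1}_+)$; only the values on the half-space matter.\<close>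

definition H10_tilde :: "(real^('n::finite option) \<Rightarrow> real) set" where
  "H10_tilde = {u. \<exists>D. has_weak_gradient half_space u D \<and>
     (\<forall>r>0.
        set_integrable lebesgue (half_ball r) (\<lambda>z. (norm (D z))\<^sup>2 + (u z)\<^sup>2) \<and>
        (\<exists>\<phi> :: nat \<Rightarrow> real^('n option) \<Rightarrow> real.
           (\<forall>k. C1c (closure (half_ball r) - {z. ht z = 0}) (\<phi> k)) \<and>
           (\<lambda>k. LINT z:half_ball r|lebesgue.
                  (norm (D z - grad (\<phi> k) z))\<^sup>2 + \<bar>u z - \<phi> k z\<bar>\<^sup>2) \<longlonglongrightarrow> 0))}"

end

theory Submission
  imports Defs
begin

text \<open>
  Put $a = n - s \in [-1, 0)$, $U = v / y^a = 1 - w$ and $C = -2a \in (0, 2]$, so that $2\gamma - 1 = n - 1 + C$.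
  The equation for $v$ becomes $\Delta U = (2\gamma - 1)\, y^{-1} \partial_y U$, and then $R_s^* \ge 0$ says
  exactly that $|\nabla \log U|^2 \le C\, y^{-1} \partial_y \log U$. Hence $U$ increases in $y$, and
  $|\nabla \log U| \le C / y$, which yields $U = O((1 + |z|)^C)$.
  Since $w$ has zero trace, $U$ tends to $1$ at the boundary in the mean; by monotonicity in $y$, $U \ge 1$.
  To improve the boundary convergence to a locally uniform one, replace $U$ by its averages over
  horizontal unit cubes, which satisfy the same equation. A barrier of degree slightly larger than $C$ and the
  maximum principle show that these averages are at most $1$, so $U = 1$.
\<close>

section \<open>Partial derivatives and curvature of conformally flat metrics\<close>

text \<open>The curvature condition is of second order in v, but second derivatives enter it only
  through the Laplacian of v, which the equation replaces by lower order terms. This leaves the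
  bound on the gradient alone, multiplied by n - 1 + C > 0. The obstacle is the boundary: y^(-1) is
  singular there, no regularity of v up to y = 0 is known, and zero trace is only an integral
  statement. It is exploited by integrating by parts against test functions that do not vanish on y
  = 0: integrals of w over slabs of thickness eps are o(eps). Two passages make this pointwise. A
  value U < 1 spreads downwards by monotonicity and would be seen by all thin slabs. Conversely,
  once U - 1 is known to be nonnegative, its horizontal average at a low height is bounded, again by
  monotonicity, by a slab integral above it. The barrier has to exceed the growth rate C at infinity
  while remaining a supersolution down to y = 0, where nothing but the smallness of the averages is
  available. The upper bound on \<gamma>, in the form C \<le> 2, is used to estimate it.\<close>

lemma pd_eqI: "(f has_derivative f') (at z) \<Longrightarrow> pd i f z = f' (axis i 1)"
  unfolding pd_def by (metis frechet_derivative_at)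

lemma pd_has_derivative:
  fixes f :: "real^'m::finite \<Rightarrow> real"
  assumes "f differentiable at z"
  shows "(f has_derivative (\<lambda>h. \<Sum>i\<in>UNIV. pd i f z * h $ i)) (at z)"
proof -
  have d: "(f has_derivative frechet_derivative f (at z)) (at z)"
    using assms by (simp add: frechet_derivative_works)
  then have lin: "linear (frechet_derivative f (at z))"
    by (rule has_derivative_linear)
  have "frechet_derivative f (at z) h = (\<Sum>i\<in>UNIV. pd i f z * h $ i)" for h
  proof -
    have "h = (\<Sum>i\<in>UNIV. (h $ i) *\<^sub>R axis i 1)"
      by (simp add: vec_eq_iff axis_def if_distrib cong: if_cong)
    then have "frechet_derivative f (at z) h = frechet_derivative f (at z) (\<Sum>i\<in>UNIV. (h $ i) *\<^sub>R axis i 1)"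
      by simp
    also have "\<dots> = (\<Sum>i\<in>UNIV. pd i f z * h $ i)"
      by (simp add: linear_sum[OF lin] linear_cmul[OF lin] pd_def mult.commute)
    finally show ?thesis .
  qed
  then have "frechet_derivative f (at z) = (\<lambda>h. \<Sum>i\<in>UNIV. pd i f z * h $ i)" by auto
  with d show ?thesis by simp
qed

lemma sum_axis: "(\<Sum>i\<in>UNIV. (F i :: real) * axis k 1 $ i) = F k"
  by (simp add: axis_def if_distrib cong: if_cong)

text \<open>This holds even where neither function is differentiable:
  \<open>frechet_derivative\<close> is a choice among the derivatives at the point, and both
  functions have the same ones.\<close>

lemma pd_cong_open:
  assumes "open S" "z \<in> S" "\<And>p. p \<in> S \<Longrightarrow> f p = g p"
  shows "pd i f z = pd i g z"
proof -
  have "(f has_derivative f') (at z) \<longleftrightarrow> (g has_derivative f') (at z)" for f'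
  proof
    show "(g has_derivative f') (at z)" if "(f has_derivative f') (at z)"
      by (rule has_derivative_transform_within_open[OF that assms(1,2)]) (use assms in auto)
    show "(f has_derivative f') (at z)" if "(g has_derivative f') (at z)"
      by (rule has_derivative_transform_within_open[OF that assms(1,2)]) (use assms in auto)
  qed
  then show ?thesis unfolding pd_def frechet_derivative_def by simp
qed

lemma differentiable_cong_open:
  fixes f g :: "'a::real_normed_vector \<Rightarrow> 'b::real_normed_vector"
  assumes "open S" "z \<in> S" "\<And>p. p \<in> S \<Longrightarrow> f p = g p" "g differentiable at z"
  shows "f differentiable at z"
proof -
  obtain g' where g': "(g has_derivative g') (at z)"
    using assms(4) unfolding differentiable_def by blast
  have "(f has_derivative g') (at z)"
    by (rule has_derivative_transform_within_open[OF g' assms(1,2)]) (use assms in auto)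
  then show ?thesis unfolding differentiable_def by blast
qed

lemma pd_add: "f differentiable at z \<Longrightarrow> g differentiable at z \<Longrightarrow>
    pd i (\<lambda>p. f p + g p) z = pd i f z + pd i g z"
  by (subst pd_eqI[OF has_derivative_add[OF pd_has_derivative pd_has_derivative]]) (auto simp: sum_axis)

lemma pd_diff: "f differentiable at z \<Longrightarrow> g differentiable at z \<Longrightarrow>
    pd i (\<lambda>p. f p - g p) z = pd i f z - pd i g z"
  by (subst pd_eqI[OF has_derivative_diff[OF pd_has_derivative pd_has_derivative]]) (auto simp: sum_axis)

lemma pd_mult: "f differentiable at z \<Longrightarrow> g differentiable at z \<Longrightarrow>
    pd i (\<lambda>p. f p * g p) z = f z * pd i g z + pd i f z * g z"
  by (subst pd_eqI[OF has_derivative_mult[OF pd_has_derivative pd_has_derivative]]) (auto simp: sum_axis)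

lemma pd_compose:
  assumes "f differentiable at z" "DERIV G (f z) :> G'"
  shows "pd i (\<lambda>p. G (f p)) z = G' * pd i f z"
    and "(\<lambda>p. G (f p)) differentiable at z"
proof -
  have "((\<lambda>p. G (f p)) has_derivative (\<lambda>h. G' * (\<Sum>i\<in>UNIV. pd i f z * h $ i))) (at z)"
    using has_derivative_compose[OF pd_has_derivative[OF assms(1)]] assms(2)
    unfolding has_field_derivative_def by blast
  then show "pd i (\<lambda>p. G (f p)) z = G' * pd i f z" "(\<lambda>p. G (f p)) differentiable at z"
    by (auto simp: differentiable_def pd_eqI sum_axis)
qed

lemma pd_const [simp]: "pd i (\<lambda>p. c) z = 0"
  by (subst pd_eqI[OF has_derivative_const]) auto

lemma pd_ht: "pd i ht z = (if i = None then 1 else 0)"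
  and ht_differentiable: "ht differentiable at z"
proof -
  have "(ht has_derivative (\<lambda>h. h $ None)) (at z)"
    unfolding ht_def by (intro bounded_linear_imp_has_derivative bounded_linear_vec_nth)
  then show "pd i ht z = (if i = None then 1 else 0)" "ht differentiable at z"
    by (auto simp: differentiable_def pd_eqI axis_def)
qed

section \<open>Conformally flat metrics: inverse, scalar curvature, hyperbolic Laplacian\<close>

lemma matrix_inv_scaleR_mat:
  assumes "c \<noteq> 0"
  shows "matrix_inv (c *\<^sub>R mat 1 :: real^'m^'m::finite) = (1/c) *\<^sub>R mat 1"
proof -
  let ?A = "c *\<^sub>R mat 1 :: real^'m^'m" and ?B = "(1/c) *\<^sub>R mat 1 :: real^'m^'m"
  have AB: "?A ** X = c *\<^sub>R X" "X ** ?A = c *\<^sub>R X" for X :: "real^'m^'m"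
    by (simp_all add: matrix_matrix_mult_def mat_def vec_eq_iff if_distrib if_distribR cong: if_cong)
  \<comment> \<open>\<open>matrix_inv\<close> is a choice; existence of a two-sided inverse makes it
    an inverse, and \<open>AB\<close> then determines it.\<close>
  have "\<exists>A'. ?A ** A' = mat 1 \<and> A' ** ?A = mat 1"
    by (rule exI[of _ ?B]) (use assms in \<open>simp add: AB\<close>)
  then have "?A ** matrix_inv ?A = mat 1"
    unfolding matrix_inv_def by (rule someI2_ex) blast
  then have "c *\<^sub>R matrix_inv ?A = mat 1" by (simp add: AB)
  then have "(1/c) *\<^sub>R (c *\<^sub>R matrix_inv ?A) = ?B" by simp
  with assms show ?thesis by simp
qed

lemma det_scaleR_mat: "det (c *\<^sub>R mat 1 :: real^'m^'m::finite) = c ^ CARD('m)"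
  by (subst det_diagonal) (auto simp: mat_def)

text \<open>\<open>G\<close> are the Christoffel symbols of exp (2 sigma) |dz|^2 when
  \<open>F\<close> is the gradient of sigma, and the left side is the quadratic part of the
  Euclidean trace of its Ricci tensor. For fixed k and i the inner sum is evaluated in closed form;
  the diagonal k = i has to be separated because several Kronecker symbols coincide there.\<close>

lemma christoffel_square_sum:
  fixes F :: "'m::finite \<Rightarrow> real"
  defines "G \<equiv> \<lambda>k i j. (if j = k then F i else 0) + (if i = k then F j else 0) - (if i = j then F k else 0)"
  shows "(\<Sum>k\<in>UNIV. \<Sum>i\<in>UNIV. \<Sum>m\<in>UNIV. G i i m * G m k k - G i k m * G m i k)
    = - (real CARD('m) - 1) * (real CARD('m) - 2) * (\<Sum>i\<in>UNIV. (F i)\<^sup>2)"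
proof -
  let ?S = "\<Sum>i\<in>UNIV. (F i)\<^sup>2" and ?N = "real CARD('m)"
  have 1: "(\<Sum>m\<in>UNIV. G i i m * G m k k) = 2 * (F k)\<^sup>2 - ?S" for i k
  proof -
    have "(\<Sum>m\<in>UNIV. G i i m * G m k k) = (\<Sum>m\<in>UNIV. (if k = m then 2 * (F k)\<^sup>2 else 0) - (F m)\<^sup>2)"
      by (intro sum.cong) (auto simp: G_def power2_eq_square)
    then show ?thesis by (simp add: sum_subtractf)
  qed
  have 2: "(\<Sum>m\<in>UNIV. G i k m * G m i k) = (F k)\<^sup>2 - (F i)\<^sup>2 + (if k = i then 2 * (F k)\<^sup>2 - ?S else 0)" for i k
  proof (cases "k = i")
    case True
    have "(\<Sum>m\<in>UNIV. G i k m * G m i k) = (\<Sum>m\<in>UNIV. (if k = m then 2 * (F k)\<^sup>2 else 0) - (F m)\<^sup>2)"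
      using True by (intro sum.cong) (auto simp: G_def power2_eq_square)
    then show ?thesis using True by (simp add: sum_subtractf)
  next
    case False
    have "(\<Sum>m\<in>UNIV. G i k m * G m i k) = (\<Sum>m\<in>UNIV. (if m = i then (F k)\<^sup>2 else 0) - (if m = k then (F i)\<^sup>2 else 0))"
      using False by (intro sum.cong) (auto simp: G_def power2_eq_square)
    then show ?thesis using False by (simp add: sum_subtractf)
  qed
  have "(\<Sum>k\<in>UNIV. \<Sum>i\<in>UNIV. \<Sum>m\<in>UNIV. G i i m * G m k k - G i k m * G m i k)
     = (\<Sum>k\<in>UNIV. \<Sum>i\<in>UNIV. (2 * (F k)\<^sup>2 - ?S) - ((F k)\<^sup>2 - (F i)\<^sup>2 + (if k = i then 2 * (F k)\<^sup>2 - ?S else 0)))"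
    by (simp add: sum_subtractf 1 2)
  also have "\<dots> = (\<Sum>k\<in>UNIV. ?N * (2 * (F k)\<^sup>2 - ?S) - (?N * (F k)\<^sup>2 - ?S + (2 * (F k)\<^sup>2 - ?S)))"
    by (simp add: sum_subtractf sum.distrib right_diff_distrib)
  also have "\<dots> = (\<Sum>k\<in>UNIV. (?N - 2) * (F k)\<^sup>2 - (?N - 2) * ?S)"
    by (simp add: algebra_simps)
  also have "\<dots> = (?N - 2) * ?S - ?N * ((?N - 2) * ?S)"
    by (simp add: sum_subtractf flip: sum_distrib_left)
  finally show ?thesis by (simp add: algebra_simps)
qed

text \<open>The functions \<open>f i\<close> are the partial derivatives of $\frac12 \log \varphi$.\<close>

lemma scalar_curvature_conformal:
  fixes \<phi> :: "real^'m::finite \<Rightarrow> real"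
  assumes S: "open S" "z \<in> S"
    and pos: "\<And>p. p \<in> S \<Longrightarrow> \<phi> p > 0"
    and diff: "\<And>p. p \<in> S \<Longrightarrow> \<phi> differentiable at p"
    and pd: "\<And>p i. p \<in> S \<Longrightarrow> pd i \<phi> p = 2 * \<phi> p * f i p"
    and f_diff: "\<And>i. f i differentiable at z"
  shows "\<phi> z * scalar_curvature (\<lambda>p. \<phi> p *\<^sub>R mat 1) z =
    - (real CARD('m) - 1) * (2 * (\<Sum>i\<in>UNIV. pd i (f i) z) + (real CARD('m) - 2) * (\<Sum>i\<in>UNIV. (f i z)\<^sup>2))"
proof -
  let ?g = "\<lambda>p. \<phi> p *\<^sub>R mat 1 :: real^'m^'m"
  let ?N = "real CARD('m)"
  define G where "G k i j p = (if j = k then f i p else 0) + (if i = k then f j p else 0) - (if i = j then f k p else 0)"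
    for i j k p
  have pd_g: "pd l (\<lambda>q. ?g q $ i $ j) p = (if i = j then 2 * \<phi> p * f l p else 0)" if "p \<in> S" for l i j p
    using pd[OF that] by (simp add: mat_def)
  have inv: "matrix_inv (?g p) $ i $ j = (if i = j then 1 / \<phi> p else 0)" if "p \<in> S" for i j p
    using pos[OF that] by (subst matrix_inv_scaleR_mat) (auto simp: mat_def)
  have chr: "christoffel ?g k i j p = G k i j p" if "p \<in> S" for k i j p
  proof -
    have "christoffel ?g k i j p = (1 / 2) * (\<Sum>l\<in>UNIV. if k = l then (1 / \<phi> p) *
       (pd i (\<lambda>q. ?g q $ j $ l) p + pd j (\<lambda>q. ?g q $ i $ l) p - pd l (\<lambda>q. ?g q $ i $ j) p) else 0)"
      unfolding christoffel_def by (simp only: inv[OF that]) (rule arg_cong[where f="\<lambda>x. 1/2 * x"], rule sum.cong, auto)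
    also have "\<dots> = G k i j p"
      unfolding pd_g[OF that] G_def using pos[OF that] by (simp add: field_simps)
    finally show ?thesis .
  qed
  have fdd: "(\<lambda>p. if b then f i p else 0) differentiable at z" for b i
    by (cases b) (auto intro: f_diff)
  have pdif: "pd l (\<lambda>p. if b then f i p else 0) z = (if b then pd l (f i) z else 0)" for l b i
    by (cases b) auto
  have pd_chr: "pd l (christoffel ?g k i j) z = (if j = k then pd l (f i) z else 0)
     + (if i = k then pd l (f j) z else 0) - (if i = j then pd l (f k) z else 0)" for l k i j
  proof -
    have "pd l (christoffel ?g k i j) z = pd l (G k i j) z"
      by (rule pd_cong_open[OF S]) (rule chr)
    also have "\<dots> = (if j = k then pd l (f i) z else 0)
     + (if i = k then pd l (f j) z else 0) - (if i = j then pd l (f k) z else 0)"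
      unfolding G_def
      by (subst pd_diff, intro differentiable_add fdd, rule fdd, subst pd_add, (rule fdd)+, simp only: pdif)
    finally show ?thesis .
  qed
  have "\<phi> z * scalar_curvature ?g z = (\<Sum>k\<in>UNIV. ricci ?g k k z)"
  proof -
    have "scalar_curvature ?g z = (\<Sum>k\<in>UNIV. \<Sum>j\<in>UNIV. if k = j then ricci ?g k j z / \<phi> z else 0)"
      unfolding scalar_curvature_def by (intro sum.cong) (auto simp: inv[OF S(2)])
    also have "\<dots> = (\<Sum>k\<in>UNIV. ricci ?g k k z / \<phi> z)" by simp
    finally show ?thesis using pos[OF S(2)] by (simp add: sum_distrib_left)
  qed
  also have "\<dots> = (\<Sum>k\<in>UNIV. \<Sum>i\<in>UNIV. pd i (christoffel ?g i k k) z - pd k (christoffel ?g i i k) z)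
     + (\<Sum>k\<in>UNIV. \<Sum>i\<in>UNIV. \<Sum>m\<in>UNIV. G i i m z * G m k k z - G i k m z * G m i k z)"
    unfolding ricci_def riemann_def by (simp add: sum.distrib chr[OF S(2)])
  also have "(\<Sum>k\<in>UNIV. \<Sum>i\<in>UNIV. \<Sum>m\<in>UNIV. G i i m z * G m k k z - G i k m z * G m i k z)
     = - (?N - 1) * (?N - 2) * (\<Sum>i\<in>UNIV. (f i z)\<^sup>2)"
    unfolding G_def by (rule christoffel_square_sum)
  \<comment> \<open>The symbol with upper index i and lower indices k, k is - \<open>f i\<close> for
    i \<noteq> k and \<open>f k\<close> for i = k; the one with lower indices i, k is always
    \<open>f k\<close>.\<close>
  also have "(\<Sum>k\<in>UNIV. \<Sum>i\<in>UNIV. pd i (christoffel ?g i k k) z - pd k (christoffel ?g i i k) z)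
     = (\<Sum>k\<in>UNIV. \<Sum>i\<in>UNIV. (if k = i then 2 * pd k (f k) z else 0) - pd i (f i) z - pd k (f k) z)"
    by (intro sum.cong) (auto simp: pd_chr)
  also have "\<dots> = (2 - 2 * ?N) * (\<Sum>i\<in>UNIV. pd i (f i) z)"
    by (simp add: sum_subtractf sum.distrib algebra_simps flip: sum_distrib_left)
  finally show ?thesis by (simp add: algebra_simps)
qed

lemma DERIV_inverse_power_mult_square:
  fixes t :: real
  assumes "t > 0"
  shows "DERIV (\<lambda>t. (1 / t) ^ N * t\<^sup>2) t :> (2 - real N) * (1 / t) ^ N * t"
proof (cases N)
  case (Suc m)
  have "DERIV (\<lambda>t. (1 / t) ^ N * t\<^sup>2) t :> (real N * (1 / t) ^ (N - 1) * (- 1 / t\<^sup>2)) * t\<^sup>2 + (1 / t) ^ N * (2 * t)"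
    using assms by (auto intro!: derivative_eq_intros simp: power2_eq_square)
  also have "(real N * (1 / t) ^ (N - 1) * (- 1 / t\<^sup>2)) * t\<^sup>2 + (1 / t) ^ N * (2 * t) = (2 - real N) * (1 / t) ^ N * t"
    using assms Suc by (simp add: field_simps)
  finally show ?thesis .
qed (auto intro!: derivative_eq_intros)

lemma laplace_beltrami_hyp:
  fixes u :: "real^('n::finite option) \<Rightarrow> real"
  assumes z: "z \<in> half_space"
    and ud: "\<And>i. pd i u differentiable at z"
  shows "laplace_beltrami hyp_metric u z
    = (ht z)\<^sup>2 * (\<Sum>i\<in>UNIV. pd i (pd i u) z) - (real CARD('n) - 1) * ht z * pd None u z"
proof -
  let ?N = "CARD('n option)"
  have oH: "open (half_space :: (real^('n option)) set)"
    unfolding half_space_def ht_def by (intro open_Collect_less continuous_intros)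
  \<comment> \<open>\<open>J (ht z)\<close> is the square root of the determinant times the diagonal
    entry of the inverse metric, that is y^(2 - N) with N = n + 1. Its y-derivative produces the
    first order term with factor 2 - N = - (n - 1).\<close>
  define J where "J t = (1 / t) ^ ?N * t\<^sup>2" for t :: real
  have dJ: "DERIV J t :> (2 - real ?N) * (1 / t) ^ ?N * t" if "t > 0" for t
    unfolding J_def using that by (rule DERIV_inverse_power_mult_square)
  have sd: "sqrt (det (hyp_metric p)) = (1 / ht p) ^ ?N" if "p \<in> half_space" for p :: "real^('n option)"
  proof -
    have "det (hyp_metric p) = ((1 / ht p) ^ ?N)\<^sup>2"
      unfolding hyp_metric_def det_scaleR_mat
      by (simp only: power_one_over[symmetric] power_mult[symmetric] mult.commute)
    then show ?thesis using that by (simp add: half_space_def)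
  qed
  have inv: "(\<Sum>j\<in>UNIV. matrix_inv (hyp_metric p) $ i $ j * pd j u p) = (ht p)\<^sup>2 * pd i u p"
    if "p \<in> half_space" for p :: "real^('n option)" and i
  proof -
    have "matrix_inv (hyp_metric p) = (ht p)\<^sup>2 *\<^sub>R mat 1"
      unfolding hyp_metric_def by (subst matrix_inv_scaleR_mat) (use that in \<open>auto simp: half_space_def\<close>)
    then have "(\<Sum>j\<in>UNIV. matrix_inv (hyp_metric p) $ i $ j * pd j u p) = (\<Sum>j\<in>UNIV. if i = j then (ht p)\<^sup>2 * pd j u p else 0)"
      by (intro sum.cong) (auto simp: mat_def)
    then show ?thesis by simp
  qed
  have pos: "ht z > 0" using z by (simp add: half_space_def)
  have pdJ: "pd i (\<lambda>p. J (ht p) * pd i u p) z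
     = J (ht z) * pd i (pd i u) z + (if i = None then (2 - real ?N) * (1 / ht z) ^ ?N * ht z * pd i u z else 0)" for i
    using pd_compose[OF ht_differentiable dJ[OF pos]]
    by (subst pd_mult) (auto simp: ud pd_ht)
  have "laplace_beltrami hyp_metric u z = 1 / ((1 / ht z) ^ ?N) * (\<Sum>i\<in>UNIV. pd i (\<lambda>p. J (ht p) * pd i u p) z)"
  proof -
    have "pd i (\<lambda>p. sqrt (det (hyp_metric p)) * (\<Sum>j\<in>UNIV. matrix_inv (hyp_metric p) $ i $ j * pd j u p)) z
      = pd i (\<lambda>p. J (ht p) * pd i u p) z" for i
      by (rule pd_cong_open[OF oH z]) (simp only: sd inv J_def mult.assoc)
    then show ?thesis unfolding laplace_beltrami_def sd[OF z] by simp
  qed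
  also have "\<dots> = 1 / ((1 / ht z) ^ ?N) * (J (ht z) * (\<Sum>i\<in>UNIV. pd i (pd i u) z) + (2 - real ?N) * (1 / ht z) ^ ?N * ht z * pd None u z)"
    by (simp add: pdJ sum.distrib sum_distrib_left)
  also have "\<dots> = (ht z)\<^sup>2 * (\<Sum>i\<in>UNIV. pd i (pd i u) z) + (2 - real ?N) * ht z * pd None u z"
    using pos by (simp add: J_def field_simps)
  finally show ?thesis by (simp add: algebra_simps)
qed

section \<open>The curvature condition as a first order inequality\<close>

lemma open_half_space: "open (half_space :: (real^('n::finite option)) set)"
  unfolding half_space_def ht_def by (intro open_Collect_less continuous_intros)

lemma C1_onD:
  assumes "C1_on V f" "open V" "z \<in> V"
  shows "f differentiable at z"
  using assms by (auto simp: C1_on_def differentiable_on_eq_differentiable_at)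

lemma C2_onD:
  assumes "C2_on V f" "open V" "z \<in> V"
  shows "f differentiable at z" "pd i f differentiable at z"
  using assms by (auto simp: C2_on_def intro: C1_onD)

text \<open>The gradient of $\log (v / y^a)$.\<close>

definition qd :: "real \<Rightarrow> (real^('n::finite option) \<Rightarrow> real) \<Rightarrow> 'n option \<Rightarrow> real^('n option) \<Rightarrow> real" where
  "qd a v i z = pd i v z / v z - (if i = None then a / ht z else 0)"

text \<open>The conformal factor is v^(2/a) / y^2, and half of its logarithm has gradient
  \<open>qd a v\<close> / a. The divergence of this gradient contains second derivatives only as the
  Laplacian of v, which \<open>v_eq\<close> expresses through v and its y-derivative. The rest
  factors as the positive number n - 1 - 2 a times the difference of the two sides.\<close>

lemma scalar_curvature_solution:
  fixes v :: "real^('n::finite option) \<Rightarrow> real" and a :: real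
  assumes v_C2: "C2_on half_space v"
    and v_pos: "\<And>z. z \<in> half_space \<Longrightarrow> v z > 0"
    and a: "a < 0" and z: "z \<in> half_space"
    and v_eq: "- laplace_beltrami hyp_metric v z - (real CARD('n) - a) * a * v z = 0"
    and scal: "scalar_curvature (\<lambda>z. (v z powr (1 / a))\<^sup>2 *\<^sub>R hyp_metric z) z \<ge> 0"
  shows "(\<Sum>i\<in>UNIV. (qd a v i z)\<^sup>2) \<le> - 2 * a * qd a v None z / ht z"
proof -
  let ?n = "real CARD('n)"
  define \<phi> where "\<phi> p = (v p powr (1 / a))\<^sup>2 * (1 / (ht p)\<^sup>2)" for p
  define f where "f i p = (1 / a) * (pd i v p / v p) - (if i = None then 1 / ht p else 0)" for i p
  note oH = open_half_space[where 'n='n]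
  note vd = C2_onD[OF v_C2 oH]
  have \<phi>_eq: "\<phi> p = exp (2 * ((1 / a) * ln (v p) - ln (ht p)))" if "p \<in> half_space" for p
  proof -
    have "v p > 0" "ht p > 0" using that v_pos by (auto simp: half_space_def)
    then have "exp (2 * ((1 / a) * ln (v p) - ln (ht p))) = (exp ((1 / a) * ln (v p)) / exp (ln (ht p)))\<^sup>2"
      by (simp only: exp_double exp_diff)
    then show ?thesis using \<open>v p > 0\<close> \<open>ht p > 0\<close> by (simp add: \<phi>_def powr_def power_divide)
  qed
  have lnv: "pd i (\<lambda>p. ln (v p)) p = pd i v p / v p" "(\<lambda>p. ln (v p)) differentiable at p"
    and lny: "pd i (\<lambda>p. ln (ht p)) p = (if i = None then 1 / ht p else 0)" "(\<lambda>p. ln (ht p)) differentiable at p"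
    if "p \<in> half_space" for p i
    using that v_pos[OF that] pd_compose[OF vd(1)[OF that] DERIV_ln_divide]
      pd_compose[OF ht_differentiable DERIV_ln_divide, of p]
    by (auto simp: half_space_def pd_ht)
  define E where "E p = 2 * ((1 / a) * ln (v p) - ln (ht p))" for p
  have E: "pd i E p = 2 * f i p" "E differentiable at p" if "p \<in> half_space" for p i
  proof -
    note l = lnv(2)[OF that] lny(2)[OF that]
    show "pd i E p = 2 * f i p"
      unfolding E_def f_def
      by (subst pd_mult, simp, intro differentiable_diff differentiable_mult l, simp,
          subst pd_diff, intro differentiable_mult l, simp, rule l,
          subst pd_mult, simp, rule l, simp add: lnv(1)[OF that] lny(1)[OF that])
    show "E differentiable at p"
      unfolding E_def by (intro differentiable_diff differentiable_mult l) auto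
  qed
  have \<phi>E: "\<phi> p = exp (E p)" if "p \<in> half_space" for p
    using \<phi>_eq[OF that] by (simp add: E_def)
  have \<phi>d: "\<phi> differentiable at p" "pd i \<phi> p = 2 * \<phi> p * f i p" if "p \<in> half_space" for p i
  proof -
    note c = pd_compose[OF E(2)[OF that] DERIV_exp]
    show "\<phi> differentiable at p"
      by (rule differentiable_cong_open[OF oH that \<phi>E c(2)])
    have "pd i \<phi> p = pd i (\<lambda>p. exp (E p)) p"
      by (rule pd_cong_open[OF oH that \<phi>E])
    then show "pd i \<phi> p = 2 * \<phi> p * f i p"
      using c(1) E(1)[OF that] \<phi>E[OF that] by simp
  qed
  have zp: "v z > 0" "ht z > 0" using z v_pos by (auto simp: half_space_def)
  note inv = pd_compose[OF vd(1)[OF z] DERIV_inverse] pd_compose[OF ht_differentiable DERIV_inverse, of z]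
  have invd: "(\<lambda>p. pd i v p / v p) differentiable at z"
     "pd j (\<lambda>p. pd i v p / v p) z = pd j (pd i v) z / v z - pd i v z * pd j v z / (v z)\<^sup>2"
     "(\<lambda>p. 1 / ht p) differentiable at z" "pd j (\<lambda>p. 1 / ht p) z = (if j = None then - 1 / (ht z)\<^sup>2 else 0)" for i j
    using zp inv vd(1)[OF z] vd(2)[OF z, of i]
    by (auto simp: divide_inverse pd_mult pd_ht power2_eq_square algebra_simps intro!: differentiable_mult)
  have fd: "f i differentiable at z" "pd i (f i) z = (1 / a) * (pd i (pd i v) z / v z - (pd i v z)\<^sup>2 / (v z)\<^sup>2)
     + (if i = None then 1 / (ht z)\<^sup>2 else 0)" for i
  proof -
    have d: "(\<lambda>p. 1 / a * (pd i v p / v p)) differentiable at z"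
      "(\<lambda>p. if i = None then 1 / ht p else 0) differentiable at z"
      by (intro differentiable_mult invd) (cases i; auto intro: invd(3))+
    show "f i differentiable at z"
      unfolding f_def by (intro differentiable_diff d)
    have "pd i (\<lambda>p. if i = None then 1 / ht p else 0) z = (if i = None then - 1 / (ht z)\<^sup>2 else 0)"
      using invd(4)[of i] by auto
    then show "pd i (f i) z = (1 / a) * (pd i (pd i v) z / v z - (pd i v z)\<^sup>2 / (v z)\<^sup>2)
     + (if i = None then 1 / (ht z)\<^sup>2 else 0)"
      unfolding f_def by (subst pd_diff[OF d], subst pd_mult) (auto intro: invd(1) simp: invd(2) power2_eq_square)
  qed
  have "(\<lambda>z. (v z powr (1 / a))\<^sup>2 *\<^sub>R hyp_metric z) = (\<lambda>p. \<phi> p *\<^sub>R mat 1)"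
    by (auto simp: \<phi>_def hyp_metric_def)
  then have "0 \<le> \<phi> z * scalar_curvature (\<lambda>p. \<phi> p *\<^sub>R mat 1) z"
    using scal \<phi>E[OF z] by simp
  also have "\<dots> = - ?n * (2 * (\<Sum>i\<in>UNIV. pd i (f i) z) + (?n - 1) * (\<Sum>i\<in>UNIV. (f i z)\<^sup>2))"
    using scalar_curvature_conformal[OF oH z, of \<phi> f] \<phi>d fd(1) by (simp add: \<phi>E)
  finally have R: "2 * (\<Sum>i\<in>UNIV. pd i (f i) z) + (?n - 1) * (\<Sum>i\<in>UNIV. (f i z)\<^sup>2) \<le> 0"
    by (simp add: mult_le_0_iff zero_le_mult_iff)
  define y where "y = ht z"
  define q where "q = qd a v None z"
  define P where "P = (\<Sum>i\<in>UNIV. (qd a v i z)\<^sup>2)"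
  define T where "T = (\<Sum>i\<in>UNIV. (pd i v z / v z)\<^sup>2)"
  define X where "X = (\<Sum>i\<in>UNIV. pd i (pd i v) z) / v z"
  have y: "y > 0" using zp by (simp add: y_def)
  have "f i z = (1 / a) * qd a v i z" for i
    using a by (auto simp: f_def qd_def field_simps)
  then have F: "(\<Sum>i\<in>UNIV. (f i z)\<^sup>2) = P / a\<^sup>2"
    by (simp add: P_def power_divide sum_divide_distrib power_mult_distrib)
  have D: "(\<Sum>i\<in>UNIV. pd i (f i) z) = (1 / a) * (X - T) + 1 / y\<^sup>2"
    by (simp add: fd(2) sum.distrib sum_subtractf X_def T_def y_def power_divide
        flip: sum_distrib_left sum_divide_distrib)
  have vy: "pd None v z / v z = q + a / y" by (simp add: q_def qd_def y_def)
  have "(pd i v z / v z)\<^sup>2 = (qd a v i z)\<^sup>2 + (if i = None then 2 * a * q / y + a\<^sup>2 / y\<^sup>2 else 0)" for i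
  proof (cases "i = None")
    case True
    have "(q + a / y)\<^sup>2 = q\<^sup>2 + (2 * a * q / y + a\<^sup>2 / y\<^sup>2)"
      by (simp add: power2_sum power_divide)
    then show ?thesis using True by (simp add: vy q_def)
  qed (auto simp: qd_def)
  then have T: "T = P + 2 * a * q / y + a\<^sup>2 / y\<^sup>2"
    by (simp add: T_def P_def sum.distrib)
  have e: "y\<^sup>2 * X - (?n - 1) * y * (pd None v z / v z) + (?n - a) * a = 0"
    using v_eq zp unfolding laplace_beltrami_hyp[OF z vd(2)[OF z]] X_def y_def[symmetric]
    by (simp add: field_simps)
  have X: "X = (?n - 1) * (q + a / y) / y - (?n - a) * a / y\<^sup>2"
  proof -
    have "X = ((?n - 1) * y * (q + a / y) - (?n - a) * a) / y\<^sup>2"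
      using y e by (simp add: vy eq_divide_eq mult.commute)
    also have "\<dots> = (?n - 1) * (q + a / y) / y - (?n - a) * a / y\<^sup>2"
      using y by (simp add: field_simps power2_eq_square)
    finally show ?thesis .
  qed
  \<comment> \<open>All multiples of 1 / y^2 cancel, since (n - 1) a - (n - a) a - a^2 + a =
    0.\<close>
  have "a * (\<Sum>i\<in>UNIV. pd i (f i) z) = (?n - 1 - 2 * a) * q / y - P"
    unfolding D X T using a y by (simp add: field_simps power2_eq_square)
  then have S: "(\<Sum>i\<in>UNIV. pd i (f i) z) = ((?n - 1 - 2 * a) * q / y - P) / a"
    using a by (simp add: field_simps)
  have "0 \<le> a\<^sup>2 * (- (2 * (((?n - 1 - 2 * a) * q / y - P) / a) + (?n - 1) * (P / a\<^sup>2)))"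
    using R unfolding S F by (intro mult_nonneg_nonneg) auto
  also have "\<dots> = (?n - 1 - 2 * a) * (- P - 2 * a * q / y)"
    using a by (simp add: field_simps power2_eq_square)
  finally have "0 \<le> (?n - 1 - 2 * a) * (- P - 2 * a * q / y)" .
  moreover have "?n - 1 - 2 * a > 0"
    using a zero_less_card_finite[where 'a='n] by linarith
  ultimately have "0 \<le> - P - 2 * a * q / y"
    by (simp only: zero_le_mult_iff) linarith
  then show ?thesis by (simp add: P_def q_def y_def)
qed

section \<open>Integration by parts for functions with zero trace\<close>

lemma has_pd_line:
  fixes f :: "real^'m::finite \<Rightarrow> real"
  assumes "f differentiable at (z + \<tau> *\<^sub>R h)"
  shows "DERIV (\<lambda>t. f (z + t *\<^sub>R h)) \<tau> :> (\<Sum>i\<in>UNIV. pd i f (z + \<tau> *\<^sub>R h) * h $ i)"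
proof -
  have "((\<lambda>t. z + t *\<^sub>R h) has_derivative (\<lambda>t. t *\<^sub>R h)) (at \<tau>)"
    by (auto intro!: derivative_eq_intros)
  note has_derivative_compose[OF this pd_has_derivative[OF assms]]
  moreover have "(\<lambda>t. \<Sum>i\<in>UNIV. pd i f (z + \<tau> *\<^sub>R h) * (t *\<^sub>R h) $ i)
      = (*) (\<Sum>i\<in>UNIV. pd i f (z + \<tau> *\<^sub>R h) * h $ i)"
    by (rule ext) (simp add: sum_distrib_left mult_ac)
  ultimately show ?thesis
    by (simp add: has_field_derivative_def)
qed

lemma has_pd_axis:
  fixes f :: "real^'m::finite \<Rightarrow> real"
  assumes "f differentiable at (z + \<tau> *\<^sub>R axis i 1)"
  shows "DERIV (\<lambda>t. f (z + t *\<^sub>R axis i 1)) \<tau> :> pd i f (z + \<tau> *\<^sub>R axis i 1)"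
  using has_pd_line[OF assms] by (simp add: sum_axis)

text \<open>The integral of \<open>g\<close> over all of space does not change when \<open>g\<close> is translated along the axis.\<close>

lemma integral_pd_eq_0:
  fixes g :: "real^'m::finite \<Rightarrow> real"
  assumes diff: "\<And>z. g differentiable at z" and cont: "continuous_on UNIV (pd i g)"
    and supp: "\<And>z. z \<notin> cbox a b \<Longrightarrow> g z = 0"
  shows "(pd i g has_integral 0) UNIV"
proof -
  define e where "e = (axis i 1 :: real^'m)"
  \<comment> \<open>The unit margin keeps every translate of the support by less than one unit
    inside one fixed box, so that differentiation under the integral takes place on a domain
    independent of t.\<close>
  define A B where "A = a - 1" and "B = b + 1"
  have sub: "cbox (a - t *\<^sub>R e) (b - t *\<^sub>R e) \<subseteq> cbox A B" if "\<bar>t\<bar> < 1" for t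
  proof -
    have te: "\<bar>t * e $ k\<bar> \<le> 1" for k using that by (simp add: e_def axis_def)
    show ?thesis
    proof
      fix x assume "x \<in> cbox (a - t *\<^sub>R e) (b - t *\<^sub>R e)"
      then have x: "a $ k - t * e $ k \<le> x $ k" "x $ k \<le> b $ k - t * e $ k" for k
        by (auto simp: mem_box_cart)
      have "a $ k - 1 \<le> x $ k" "x $ k \<le> b $ k + 1" for k
        using x[of k] te[of k] by linarith+
      then show "x \<in> cbox A B" by (simp add: mem_box_cart A_def B_def)
    qed
  qed
  have gc: "continuous_on UNIV g"
    using differentiable_imp_continuous_within[OF diff] by (simp add: continuous_at_imp_continuous_on)
  have const: "integral (cbox A B) (\<lambda>z. g (z + t *\<^sub>R e)) = integral (cbox a b) g" if "t \<in> {-1<..<1}" for t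
  proof -
    have "(g has_integral integral (cbox a b) g) (cbox a b)"
      by (intro integrable_integral integrable_continuous continuous_on_subset[OF gc]) auto
    from has_integral_affinity'[OF this, of 1 "t *\<^sub>R e"]
    have "((\<lambda>z. g (z + t *\<^sub>R e)) has_integral integral (cbox a b) g) (cbox (a - t *\<^sub>R e) (b - t *\<^sub>R e))"
      by simp
    then have "((\<lambda>z. g (z + t *\<^sub>R e)) has_integral integral (cbox a b) g) (cbox A B)"
    proof (rule has_integral_on_superset)
      show "g (z + t *\<^sub>R e) = 0" if "z \<notin> cbox (a - t *\<^sub>R e) (b - t *\<^sub>R e)" for z
        using that by (intro supp) (auto simp: mem_box_cart diff_le_eq le_diff_eq)
    next
      show "cbox (a - t *\<^sub>R e) (b - t *\<^sub>R e) \<subseteq> cbox A B" by (rule sub) (use that in auto)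
    qed
    then show ?thesis by (rule integral_unique)
  qed
  have "((\<lambda>t. integral (cbox A B) (\<lambda>z. g (z + t *\<^sub>R e))) has_field_derivative
      integral (cbox A B) (\<lambda>z. pd i g (z + 0 *\<^sub>R e))) (at 0 within {-1<..<1})"
  proof (rule leibniz_rule_field_derivative[where f="\<lambda>t z. g (z + t *\<^sub>R e)" and fx="\<lambda>t z. pd i g (z + t *\<^sub>R e)"])
    show "((\<lambda>t. g (z + t *\<^sub>R e)) has_field_derivative pd i g (z + t *\<^sub>R e)) (at t within {-1<..<1})" for t z
      unfolding e_def by (rule has_field_derivative_at_within[OF has_pd_axis[OF diff]])
    show "(\<lambda>z. g (z + t *\<^sub>R e)) integrable_on cbox A B" for t
      by (intro integrable_continuous continuous_on_compose2[OF gc] continuous_intros) auto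
    show "continuous_on ({-1<..<1} \<times> cbox A B) (\<lambda>(t, z). pd i g (z + t *\<^sub>R e))"
      unfolding case_prod_unfold
      by (intro continuous_on_compose2[OF cont] continuous_intros) auto
  qed auto
  moreover have "((\<lambda>t. integral (cbox A B) (\<lambda>z. g (z + t *\<^sub>R e))) has_field_derivative 0) (at 0 within {-1<..<1})"
    by (rule has_field_derivative_at_within, rule has_field_derivative_transform_within_open[OF DERIV_const, where S="{-1<..<1}"])
      (use const in auto)
  ultimately have "integral (cbox A B) (pd i g) = 0"
    by (simp add: at_within_open[of 0 "{-1<..<1}"] DERIV_unique)
  moreover have "(pd i g has_integral integral (cbox A B) (pd i g)) (cbox A B)"
    by (intro integrable_integral integrable_continuous continuous_on_subset[OF cont]) auto
  ultimately have I: "(pd i g has_integral 0) (cbox A B)" by simp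
  show ?thesis
  proof (rule has_integral_on_superset[OF I])
    fix z assume z: "z \<notin> cbox A B"
    have "pd i g z = pd i (\<lambda>_. 0) z"
    proof (rule pd_cong_open)
      show "open (- cbox A B)" by (simp add: open_Compl closed_cbox)
      have "cbox a b \<subseteq> cbox A B" using sub[of 0] by simp
      then show "g p = 0" if "p \<in> - cbox A B" for p using that supp by auto
    qed (use z in auto)
    then show "pd i g z = 0" by simp
  qed auto
qed

section \<open>Measurability, and test functions on half balls\<close>

lemma set_integrable_bounded:
  fixes f :: "'a::euclidean_space \<Rightarrow> 'b::euclidean_space"
  assumes "A \<in> lmeasurable" "set_borel_measurable lebesgue A f" "\<And>x. x \<in> A \<Longrightarrow> norm (f x) \<le> M"
  shows "set_integrable lebesgue A f"
proof (rule set_integrable_bound)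
  show "set_integrable lebesgue A (\<lambda>_. M)"
    using assms(1) unfolding set_integrable_def by (intro integrable_scaleR_left integrable_real_indicator) (auto simp: fmeasurable_def)
qed (use assms in \<open>force+\<close>)

text \<open>Weak gradients come with integrability on compact subsets only. On an open set f is the
  pointwise limit of its restrictions to an exhaustion by compact sets, hence measurable.\<close>

lemma set_borel_measurable_exhaustion:
  fixes f :: "'a::euclidean_space \<Rightarrow> 'b::euclidean_space"
  assumes "open S" and K: "\<And>K. compact K \<Longrightarrow> K \<subseteq> S \<Longrightarrow> set_integrable lebesgue K f"
  shows "set_borel_measurable lebesgue S f"
proof -
  obtain C where C: "\<And>n. compact (C n)" "\<And>n. C n \<subseteq> S" "\<And>n. C n \<subseteq> interior (C (Suc n))" "\<Union>(range C) = S"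
    using open_Union_compact_subsets[OF assms(1)] by metis
  have mono: "C m \<subseteq> C n" if "m \<le> n" for m n :: nat
    using C(3) interior_subset by (intro lift_Suc_mono_le[OF _ that]) blast
  show ?thesis
    unfolding set_borel_measurable_def
  proof (rule borel_measurable_LIMSEQ_metric)
    show "(\<lambda>x. indicat_real (C n) x *\<^sub>R f x) \<in> borel_measurable lebesgue" for n
      using K[OF C(1,2)] unfolding set_integrable_def by (rule borel_measurable_integrable)
    show "(\<lambda>n. indicat_real (C n) x *\<^sub>R f x) \<longlonglongrightarrow> indicat_real S x *\<^sub>R f x" for x
    proof (cases "x \<in> S")
      case True
      then obtain m where "x \<in> C m" using C(4) by auto
      then have "\<forall>n\<ge>m. indicat_real (C n) x *\<^sub>R f x = indicat_real S x *\<^sub>R f x"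
        using mono True by (auto simp: indicator_def)
      then show ?thesis by (intro tendsto_eventually) (auto simp: eventually_sequentially)
    next
      case False
      then have "indicat_real (C n) x *\<^sub>R f x = indicat_real S x *\<^sub>R f x" for n
        using C(2)[of n] by (auto simp: indicator_def)
      then show ?thesis by (simp only: tendsto_const)
    qed
  qed
qed

lemma open_half_ball: "open (half_ball r :: (real^('n::finite option)) set)"
  and bounded_half_ball: "bounded (half_ball r :: (real^('n::finite option)) set)"
  and half_ball_lmeasurable: "(half_ball r :: (real^('n::finite option)) set) \<in> lmeasurable"
  and half_ball_subset: "(half_ball r :: (real^('n::finite option)) set) \<subseteq> half_space"
proof -
  have eq: "half_ball r = half_space \<inter> ball (0 :: real^('n option)) r"
    by (auto simp: half_ball_def)
  show o: "open (half_ball r :: (real^('n option)) set)"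
    unfolding eq by (intro open_Int open_half_space open_ball)
  show b: "bounded (half_ball r :: (real^('n option)) set)"
    unfolding eq by (intro bounded_Int) simp
  show "(half_ball r :: (real^('n option)) set) \<in> lmeasurable"
    by (rule lmeasurable_open[OF b o])
  show "(half_ball r :: (real^('n option)) set) \<subseteq> half_space"
    unfolding eq by simp
qed

lemma set_borel_measurable_continuous_open:
  fixes f :: "'a::euclidean_space \<Rightarrow> 'b::euclidean_space"
  assumes "open S" "continuous_on S f"
  shows "set_borel_measurable lebesgue S f"
proof -
  have "set_borel_measurable borel S f"
    unfolding set_borel_measurable_def
    by (rule borel_measurable_continuous_on_indicator) (use assms in auto)
  then show ?thesis
    unfolding set_borel_measurable_def by (intro measurable_completion) simp
qed

lemma bounded_realD: "bounded (X :: real set) \<Longrightarrow> \<exists>M>0. \<forall>x\<in>X. \<bar>x\<bar> \<le> M"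
  unfolding bounded_pos real_norm_def by blast

text \<open>The support is compact in the closed half ball without y = 0: it keeps away from y = 0
  but may reach the spherical part of the frontier. This is why \<open>K\<close> lies in the
  half-space rather than in the half ball. The uniform bounds come from compactness of the support;
  off it \<phi> vanishes on an open set, so the derivatives vanish too.\<close>

lemma C1c_half_ball:
  fixes \<phi> :: "real^('n::finite option) \<Rightarrow> real"
  assumes "C1c (closure (half_ball r) - {z. ht z = 0}) \<phi>"
  shows "C1_on (half_ball r) \<phi>"
    and "\<exists>M. \<forall>z\<in>half_ball r. \<bar>\<phi> z\<bar> \<le> M \<and> (\<forall>i. \<bar>pd i \<phi> z\<bar> \<le> M)"
    and "\<exists>K. compact K \<and> K \<subseteq> half_space \<and> (\<forall>z\<in>half_ball r. z \<notin> K \<longrightarrow> \<phi> z = 0)"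
proof -
  define S :: "(real^('n option)) set" where "S = closure (half_ball r) - {z. ht z = 0}"
  define K where "K = closure {z \<in> S. \<phi> z \<noteq> 0}"
  obtain V where V: "open V" "S \<subseteq> V" "C1_on V \<phi>" and K: "compact K" "K \<subseteq> S"
    using assms unfolding C1c_def S_def[symmetric] K_def by blast
  have BS: "half_ball r \<subseteq> S"
    using closure_subset[of "half_ball r"] by (auto simp: S_def half_ball_def half_space_def)
  have out: "\<phi> z = 0" if "z \<in> half_ball r" "z \<notin> K" for z
    using that BS closure_subset[of "{z \<in> S. \<phi> z \<noteq> 0}"] by (auto simp: K_def)
  have "closed {z :: real^('n option). 0 \<le> ht z}"
    unfolding ht_def by (intro closed_Collect_le continuous_intros)
  then have "closure (half_ball r) \<subseteq> {z :: real^('n option). 0 \<le> ht z}"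
    by (intro closure_minimal) (auto simp: half_ball_def half_space_def)
  then have "S \<subseteq> half_space"
    by (force simp: S_def half_space_def)
  with K out show "\<exists>K. compact K \<and> K \<subseteq> half_space \<and> (\<forall>z\<in>half_ball r. z \<notin> K \<longrightarrow> \<phi> z = 0)"
    by blast
  show "C1_on (half_ball r) \<phi>"
    using V(3) BS V(2) unfolding C1_on_def
    by (meson continuous_on_subset differentiable_on_subset order_trans)
  have KV: "K \<subseteq> V" using K V by blast
  have "continuous_on K \<phi>"
    using V(3) KV unfolding C1_on_def
    by (meson continuous_on_subset differentiable_imp_continuous_on)
  then have "bounded (\<phi> ` K)" by (intro compact_imp_bounded compact_continuous_image K)
  moreover have "bounded (pd i \<phi> ` K)" for i
    using V(3) KV unfolding C1_on_def
    by (intro compact_imp_bounded compact_continuous_image K) (meson continuous_on_subset)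
  ultimately have "bounded (\<phi> ` K \<union> (\<Union>i\<in>UNIV. pd i \<phi> ` K))"
    by (intro bounded_Un[THEN iffD2] conjI bounded_UN) auto
  then obtain M where M: "\<forall>x\<in>\<phi> ` K \<union> (\<Union>i\<in>UNIV. pd i \<phi> ` K). \<bar>x\<bar> \<le> M" "M > 0"
    using bounded_realD by metis
  show "\<exists>M. \<forall>z\<in>half_ball r. \<bar>\<phi> z\<bar> \<le> M \<and> (\<forall>i. \<bar>pd i \<phi> z\<bar> \<le> M)"
  proof (intro exI ballI)
    fix z :: "real^('n option)" assume z: "z \<in> half_ball r"
    show "\<bar>\<phi> z\<bar> \<le> M \<and> (\<forall>i. \<bar>pd i \<phi> z\<bar> \<le> M)"
    proof (cases "z \<in> K")
      case True
      then show ?thesis using M(1) by auto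
    next
      case False
      have "pd i \<phi> z = pd i (\<lambda>_. 0) z" for i
      proof (rule pd_cong_open)
        show "open (half_ball r - K)"
          using open_half_ball compact_imp_closed[OF K(1)] by (rule open_Diff)
      qed (use z False out in auto)
      then show ?thesis using False z out M(2) by simp
    qed
  qed
qed

text \<open>The two factors cut off complementary parts of the frontier: \<phi> vanishes near y = 0
  and \<psi> near the sphere. The product, extended by 0, is therefore C^1 on the whole space with
  support in the compact set \<open>K'\<close>, and its y-derivative has integral 0.\<close>

lemma C1c_half_ball_parts:
  fixes \<phi> \<psi> :: "real^('n::finite option) \<Rightarrow> real"
  assumes \<phi>: "C1c (closure (half_ball r) - {z. ht z = 0}) \<phi>"
    and \<psi>d: "\<And>z. \<psi> differentiable at z" and \<psi>c: "continuous_on UNIV (pd None \<psi>)"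
    and r': "r' < r" and \<psi>0: "\<And>z. z \<in> half_ball r \<Longrightarrow> norm z > r' \<Longrightarrow> \<psi> z = 0"
  shows "((\<lambda>z. \<phi> z * pd None \<psi> z + pd None \<phi> z * \<psi> z) has_integral 0) (half_ball r)"
proof -
  define F where "F z = \<phi> z * pd None \<psi> z + pd None \<phi> z * \<psi> z" for z
  define g where "g z = (if z \<in> half_ball r then \<phi> z * \<psi> z else 0)" for z
  obtain K where K: "compact K" "K \<subseteq> half_space" "\<And>z. z \<in> half_ball r \<Longrightarrow> z \<notin> K \<Longrightarrow> \<phi> z = 0"
    using C1c_half_ball(3)[OF \<phi>] by blast
  define K' where "K' = K \<inter> cball 0 r'"
  have K': "open (- K')" "K' \<subseteq> half_ball r"
    using K(1,2) r' by (auto simp: K'_def half_ball_def intro!: closed_Int compact_imp_closed)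
  have g0: "g z = 0" if "z \<in> - K'" for z
    using that K(3) \<psi>0[of z] by (force simp: K'_def g_def)
  have \<phi>d: "\<phi> differentiable at z" if "z \<in> half_ball r" for z
    using C1_onD[OF C1c_half_ball(1)[OF \<phi>] open_half_ball that] .
  have \<psi>cont: "continuous_on UNIV \<psi>"
    using differentiable_imp_continuous_within[OF \<psi>d] by (simp add: continuous_at_imp_continuous_on)
  have gd: "g differentiable at z" for z
  proof (cases "z \<in> half_ball r")
    case True
    show ?thesis
      by (rule differentiable_cong_open[OF open_half_ball True, where g="\<lambda>z. \<phi> z * \<psi> z"])
        (auto simp: g_def intro!: differentiable_mult \<phi>d True \<psi>d)
  next
    case False
    with K'(2) have "z \<in> - K'" by blast
    then show ?thesis
      by (rule differentiable_cong_open[OF K'(1), where g="\<lambda>z. 0"]) (auto simp: g0)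
  qed
  have pd_g0: "pd None g z = 0" if "z \<in> - K'" for z
    using pd_cong_open[OF K'(1) that, of g "\<lambda>_. 0" None] g0 by simp
  have pd_g1: "pd None g z = F z" if "z \<in> half_ball r" for z
  proof -
    have "pd None g z = pd None (\<lambda>z. \<phi> z * \<psi> z) z"
      by (rule pd_cong_open[OF open_half_ball that]) (simp add: g_def)
    then show ?thesis by (simp add: F_def pd_mult[OF \<phi>d[OF that] \<psi>d])
  qed
  have "C1_on (half_ball r) \<phi>" by (rule C1c_half_ball(1)[OF \<phi>])
  then have Fc: "continuous_on (half_ball r) F"
    unfolding F_def C1_on_def
    by (intro continuous_intros continuous_on_subset[OF \<psi>c] continuous_on_subset[OF \<psi>cont])
      (auto intro: differentiable_imp_continuous_on)
  have "continuous_on (half_ball r \<union> - K') (pd None g)"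
  proof (rule continuous_on_open_Un)
    show "continuous_on (half_ball r) (pd None g)"
      using Fc by (rule continuous_on_eq) (simp add: pd_g1)
    show "continuous_on (- K') (pd None g)"
      by (rule continuous_on_eq[OF continuous_on_const[of _ 0]]) (simp add: pd_g0)
  qed (use K' open_half_ball in auto)
  moreover have "half_ball r \<union> - K' = UNIV" using K' by blast
  ultimately have gc: "continuous_on UNIV (pd None g)" by simp
  obtain a where "half_ball r \<subseteq> cbox (- a) (a :: real^('n option))"
    using bounded_subset_cbox_symmetric[OF bounded_half_ball] by blast
  then have "g z = 0" if "z \<notin> cbox (- a) a" for z
    using that by (auto simp: g_def)
  then have "(pd None g has_integral 0) UNIV"
    by (rule integral_pd_eq_0[OF gd gc])
  moreover have "pd None g z = (if z \<in> half_ball r then F z else 0)" for z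
    using pd_g1 pd_g0 K' by auto
  ultimately show ?thesis
    unfolding F_def[symmetric] by (simp add: has_integral_restrict_UNIV cong: has_integral_cong)
qed

text \<open>A substitute for the Cauchy-Schwarz inequality for integrals: smallness of squares
  bounds first powers, at the price of a free parameter that is sent to 0 afterwards.\<close>

lemma le_add_square_div:
  fixes x \<delta> :: real
  assumes "\<delta> > 0"
  shows "\<bar>x\<bar> \<le> \<delta> + x\<^sup>2 / \<delta>"
proof -
  have "0 \<le> (\<bar>x\<bar> - \<delta>)\<^sup>2" "0 \<le> \<bar>x\<bar> * \<delta>" using assms by simp_all
  moreover have "(\<bar>x\<bar> - \<delta>)\<^sup>2 = x\<^sup>2 - 2 * (\<bar>x\<bar> * \<delta>) + \<delta>\<^sup>2"
    by (simp only: power2_diff power2_abs)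
  ultimately have "\<bar>x\<bar> * \<delta> \<le> \<delta>\<^sup>2 + x\<^sup>2" by linarith
  then have "\<bar>x\<bar> \<le> (\<delta>\<^sup>2 + x\<^sup>2) / \<delta>" using assms by (simp only: pos_le_divide_eq)
  then show ?thesis using assms by (simp add: add_divide_distrib power2_eq_square)
qed

text \<open>Here zero trace is used: \<psi> may be nonzero on y = 0, yet no boundary term appears.
  The identity is exact for each \<open>\<phi> k\<close>, and the error made by replacing w with
  \<open>\<phi> k\<close> is controlled by the norm in which \<open>\<phi> k\<close> converges to
  w.\<close>

lemma zero_trace_parts:
  fixes w \<psi> :: "real^('n::finite option) \<Rightarrow> real"
  assumes wD: "has_weak_gradient half_space w D"
    and sq: "set_integrable lebesgue (half_ball r) (\<lambda>z. (norm (D z))\<^sup>2 + (w z)\<^sup>2)"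
    and \<phi>: "\<And>k. C1c (closure (half_ball r) - {z. ht z = 0}) (\<phi> k)"
    and lim: "(\<lambda>k. LINT z:half_ball r|lebesgue.
                  (norm (D z - grad (\<phi> k) z))\<^sup>2 + \<bar>w z - \<phi> k z\<bar>\<^sup>2) \<longlonglongrightarrow> 0"
    and \<psi>d: "\<And>z. \<psi> differentiable at z" and \<psi>c: "continuous_on UNIV (pd None \<psi>)"
    and r': "r' < r" and \<psi>0: "\<And>z. z \<in> half_ball r \<Longrightarrow> norm z > r' \<Longrightarrow> \<psi> z = 0"
  shows "set_integrable lebesgue (half_ball r) (\<lambda>z. norm (D z))"
    and "set_integrable lebesgue (half_ball r) (\<lambda>z. w z * pd None \<psi> z)"
    and "(LINT z:half_ball r|lebesgue. w z * pd None \<psi> z) = - (LINT z:half_ball r|lebesgue. D z $ None * \<psi> z)"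
proof -
  define B :: "(real^('n option)) set" where "B = half_ball r"
  have oB: "open B" and mB: "B \<in> lmeasurable"
    by (simp_all add: B_def open_half_ball half_ball_lmeasurable)
  have sub: "K \<subseteq> half_space" if "K \<subseteq> B" for K
    using that half_ball_subset[of r] by (auto simp: B_def)
  have wm: "set_borel_measurable lebesgue B w" and Dm: "set_borel_measurable lebesgue B D"
  proof -
    have KI: "set_integrable lebesgue K w" "set_integrable lebesgue K D" if "compact K" "K \<subseteq> B" for K
      using wD that sub unfolding has_weak_gradient_def by blast+
    show "set_borel_measurable lebesgue B w"
      by (rule set_borel_measurable_exhaustion[OF oB]) (rule KI(1))
    show "set_borel_measurable lebesgue B D"
      by (rule set_borel_measurable_exhaustion[OF oB]) (rule KI(2))
  qed
  have \<psi>cont: "continuous_on UNIV \<psi>"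
    using differentiable_imp_continuous_within[OF \<psi>d] by (simp add: continuous_at_imp_continuous_on)
  have bdd: "bounded (f ` cball 0 r)" if "continuous_on UNIV f" for f :: "real^('n option) \<Rightarrow> real"
    by (rule compact_imp_bounded[OF compact_continuous_image[OF continuous_on_subset[OF that]]]) auto
  have "bounded (\<psi> ` cball 0 r \<union> pd None \<psi> ` cball 0 r)"
    using bdd[OF \<psi>cont] bdd[OF \<psi>c] by simp
  then obtain M where M: "\<forall>x\<in>\<psi> ` cball 0 r \<union> pd None \<psi> ` cball 0 r. \<bar>x\<bar> \<le> M" and M0: "M > 0"
    using bounded_realD by metis
  have Bc: "B \<subseteq> cball 0 r" by (auto simp: B_def half_ball_def)
  have M1: "\<bar>\<psi> z\<bar> \<le> M" "\<bar>pd None \<psi> z\<bar> \<le> M" if "z \<in> B" for z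
    using M that Bc by auto
  have one: "set_integrable lebesgue B (\<lambda>_. c :: real)" for c
    by (rule set_integrable_bounded[OF mB, of _ "\<bar>c\<bar>"])
      (auto intro!: set_borel_measurable_continuous_open oB)
  have prod_m: "set_borel_measurable lebesgue B (\<lambda>z. f z * g z)"
    if "set_borel_measurable lebesgue B f" "set_borel_measurable lebesgue B g" for f g :: "real^('n option) \<Rightarrow> real"
  proof -
    have "(\<lambda>z. indicat_real B z *\<^sub>R (f z * g z)) = (\<lambda>z. (indicat_real B z *\<^sub>R f z) * (indicat_real B z *\<^sub>R g z))"
      by (auto simp: indicator_def)
    then show ?thesis using that by (simp add: set_borel_measurable_def)
  qed
  have \<psi>m: "set_borel_measurable lebesgue B \<psi>" "set_borel_measurable lebesgue B (pd None \<psi>)"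
    by (rule set_borel_measurable_continuous_open[OF oB continuous_on_subset[OF \<psi>cont]]
        set_borel_measurable_continuous_open[OF oB continuous_on_subset[OF \<psi>c]], simp)+
  have DNm: "set_borel_measurable lebesgue B (\<lambda>z. D z $ i)" for i
  proof -
    have "(\<lambda>z. indicat_real B z *\<^sub>R (D z $ i)) = (\<lambda>z. (indicat_real B z *\<^sub>R D z) $ i)" by auto
    moreover have "(\<lambda>z. (indicat_real B z *\<^sub>R D z) $ i) \<in> borel_measurable lebesgue"
      using Dm unfolding set_borel_measurable_def
      by (rule borel_measurable_continuous_on[rotated]) (intro continuous_intros)
    ultimately show ?thesis by (simp add: set_borel_measurable_def)
  qed
  have Dnm: "set_borel_measurable lebesgue B (\<lambda>z. norm (D z))"
  proof -
    have "(\<lambda>z. indicat_real B z *\<^sub>R norm (D z)) = (\<lambda>z. norm (indicat_real B z *\<^sub>R D z))"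
      by (auto simp: indicator_def)
    moreover note [measurable] = Dm[unfolded set_borel_measurable_def]
    ultimately show ?thesis unfolding set_borel_measurable_def by (simp only:) measurable
  qed
  have sq1: "set_integrable lebesgue B (\<lambda>z. c * (1 + ((norm (D z))\<^sup>2 + (w z)\<^sup>2)))" for c
    by (rule set_integrable_mult_right, rule set_integral_add(1)[OF one[of 1] sq[folded B_def]])
  have le1: "\<bar>x\<bar> \<le> 1 + x\<^sup>2" for x :: real using le_add_square_div[of 1 x] by simp
  have le2: "norm (norm (D z)) \<le> norm (1 * (1 + ((norm (D z))\<^sup>2 + (w z)\<^sup>2)))"
      "norm (w z) \<le> norm (1 * (1 + ((norm (D z))\<^sup>2 + (w z)\<^sup>2)))" for z
    using le1[of "norm (D z)"] le1[of "w z"] zero_le_power2[of "norm (D z)"] zero_le_power2[of "w z"]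
    unfolding mult_1 real_norm_def by linarith+
  show Dni: "set_integrable lebesgue (half_ball r) (\<lambda>z. norm (D z))"
    unfolding B_def[symmetric]
    by (rule set_integrable_bound[OF sq1[of 1] Dnm], rule AE_I2, rule impI, rule le2)
  have wi: "set_integrable lebesgue B w"
    by (rule set_integrable_bound[OF sq1[of 1] wm], rule AE_I2, rule impI, rule le2)
  have DNi: "set_integrable lebesgue B (\<lambda>z. D z $ i)" for i
    using Dni[folded B_def] by (rule set_integrable_bound[OF _ DNm]) (auto intro: component_le_norm_cart)
  have mult_i: "set_integrable lebesgue B (\<lambda>z. f z * g z)"
    if "set_integrable lebesgue B f" "set_borel_measurable lebesgue B f" "set_borel_measurable lebesgue B g"
      "\<And>z. z \<in> B \<Longrightarrow> \<bar>g z\<bar> \<le> M" for f g :: "real^('n option) \<Rightarrow> real"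
  proof (rule set_integrable_bound)
    show "set_integrable lebesgue B (\<lambda>z. M * f z)" by (intro set_integrable_mult_right that)
    show "AE z in lebesgue. z \<in> B \<longrightarrow> norm (f z * g z) \<le> norm (M * f z)"
      using that(4) M0 by (auto simp: abs_mult mult.commute[of M] intro!: mult_left_mono)
  qed (intro prod_m that)
  show wpi: "set_integrable lebesgue (half_ball r) (\<lambda>z. w z * pd None \<psi> z)"
    unfolding B_def[symmetric] by (rule mult_i[OF wi wm \<psi>m(2) M1(2)])
  have DNpi: "set_integrable lebesgue B (\<lambda>z. D z $ None * \<psi> z)"
    by (rule mult_i[OF DNi DNm \<psi>m(1) M1(1)])
  define I where "I = (LINT z:B|lebesgue. w z * pd None \<psi> z + D z $ None * \<psi> z)"
  have I: "I = (LINT z:B|lebesgue. w z * pd None \<psi> z) + (LINT z:B|lebesgue. D z $ None * \<psi> z)"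
    unfolding I_def by (rule set_integral_add(2)[OF wpi[folded B_def] DNpi])
  define e where "e k z = (norm (D z - grad (\<phi> k) z))\<^sup>2 + \<bar>w z - \<phi> k z\<bar>\<^sup>2" for k z
  define m where "m = measure lebesgue B"
  \<comment> \<open>Subtracting the identity for \<open>\<phi> k\<close>, whose integral is 0,
    leaves differences multiplied by functions bounded by \<open>M\<close>. Letting k grow for fixed
    \<delta> removes the second term, and \<delta> is arbitrary in the first.\<close>
  have est: "\<bar>I\<bar> \<le> M * (2 * \<delta> * m) + M / \<delta> * (LINT z:B|lebesgue. e k z)" if "\<delta> > 0" for k \<delta>
  proof -
    note C = C1c_half_ball[OF \<phi>[of k], folded B_def]
    have \<phi>c: "continuous_on B (\<phi> k)" "continuous_on B (pd i (\<phi> k))" for i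
      using C(1) by (auto simp: C1_on_def differentiable_imp_continuous_on)
    have \<phi>m: "set_borel_measurable lebesgue B (\<phi> k)" "set_borel_measurable lebesgue B (pd i (\<phi> k))"
       for i by (auto intro!: set_borel_measurable_continuous_open oB \<phi>c)
    obtain N where N: "\<And>z. z \<in> B \<Longrightarrow> \<bar>\<phi> k z\<bar> \<le> N" "\<And>z i. z \<in> B \<Longrightarrow> \<bar>pd i (\<phi> k) z\<bar> \<le> N"
      using C(2) by blast
    have \<phi>i: "set_integrable lebesgue B (\<phi> k)" "set_integrable lebesgue B (pd i (\<phi> k))" for i
      using N by (auto intro!: set_integrable_bounded[OF mB, of _ N] \<phi>m)
    have gm: "set_borel_measurable lebesgue B (grad (\<phi> k))"
    proof (rule set_borel_measurable_continuous_open[OF oB])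
      show "continuous_on B (grad (\<phi> k))"
        unfolding grad_def[abs_def] by (intro continuous_on_vec_lambda \<phi>c)
    qed
    have gN: "norm (grad (\<phi> k) z) \<le> real CARD('n option) * N" if "z \<in> B" for z
    proof -
      have "norm (grad (\<phi> k) z) \<le> (\<Sum>i\<in>UNIV. \<bar>grad (\<phi> k) z $ i\<bar>)" by (rule norm_le_l1_cart)
      also have "\<dots> \<le> (\<Sum>i\<in>(UNIV :: 'n option set). N)"
        by (intro sum_mono) (simp add: grad_def N(2)[OF that])
      finally show ?thesis by simp
    qed
    define c where "c = real CARD('n option) * N"
    have em: "set_borel_measurable lebesgue B (e k)"
    proof -
      have "(\<lambda>z. indicat_real B z *\<^sub>R e k z) = (\<lambda>z. (norm (indicat_real B z *\<^sub>R D z - indicat_real B z *\<^sub>R grad (\<phi> k) z))\<^sup>2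
         + \<bar>indicat_real B z *\<^sub>R w z - indicat_real B z *\<^sub>R \<phi> k z\<bar>\<^sup>2)"
        by (auto simp: indicator_def e_def)
      moreover note [measurable] = Dm[unfolded set_borel_measurable_def] gm[unfolded set_borel_measurable_def]
        wm[unfolded set_borel_measurable_def] \<phi>m(1)[unfolded set_borel_measurable_def]
      ultimately show ?thesis
        unfolding set_borel_measurable_def by (simp only:) measurable
    qed
    have ei: "set_integrable lebesgue B (e k)"
    proof (rule set_integrable_bound[OF _ em])
      show "set_integrable lebesgue B (\<lambda>z. 2 * ((norm (D z))\<^sup>2 + (w z)\<^sup>2) + 2 * (c\<^sup>2 + N\<^sup>2))"
        by (rule set_integral_add(1)[OF set_integrable_mult_right one]) (rule sq[folded B_def])
      have "e k z \<le> 2 * ((norm (D z))\<^sup>2 + (w z)\<^sup>2) + 2 * (c\<^sup>2 + N\<^sup>2)" if z: "z \<in> B" for z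
      proof -
        have sq2: "(x + y)\<^sup>2 \<le> 2 * x\<^sup>2 + 2 * y\<^sup>2" for x y :: real
          using zero_le_power2[of "x - y"] unfolding power2_sum power2_diff by linarith
        have "(norm (D z - grad (\<phi> k) z))\<^sup>2 \<le> (norm (D z) + c)\<^sup>2"
          using gN[OF z] norm_triangle_ineq4[of "D z" "grad (\<phi> k) z"] by (intro power_mono) (auto simp: c_def)
        moreover have "\<bar>w z - \<phi> k z\<bar>\<^sup>2 \<le> (\<bar>w z\<bar> + N)\<^sup>2"
          using N(1)[OF z] by (intro power_mono) auto
        ultimately show ?thesis
          using sq2[of "norm (D z)" c] sq2[of "\<bar>w z\<bar>" N] by (simp add: e_def)
      qed
      moreover have "e k z \<ge> 0" for z by (simp add: e_def)
      ultimately show "AE z in lebesgue. z \<in> B \<longrightarrow> norm (e k z) \<le> norm (2 * ((norm (D z))\<^sup>2 + (w z)\<^sup>2) + 2 * (c\<^sup>2 + N\<^sup>2))"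
        by (intro AE_I2) fastforce
    qed
    define F where "F z = \<phi> k z * pd None \<psi> z + pd None (\<phi> k) z * \<psi> z" for z
    have Fi: "set_integrable lebesgue B F"
      unfolding F_def by (intro set_integral_add(1) mult_i \<phi>i \<phi>m \<psi>m M1)
    have "(F has_integral 0) B"
      unfolding F_def B_def by (rule C1c_half_ball_parts[OF \<phi> \<psi>d \<psi>c r' \<psi>0])
    then have F0: "(LINT z:B|lebesgue. F z) = 0"
      using set_lebesgue_integral_eq_integral(2)[OF Fi] by (simp add: integral_unique)
    have hi: "set_integrable lebesgue B (\<lambda>z. w z * pd None \<psi> z + D z $ None * \<psi> z)"
      by (intro set_integral_add(1) wpi[folded B_def] DNpi)
    have "I = (LINT z:B|lebesgue. (w z * pd None \<psi> z + D z $ None * \<psi> z) - F z)"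
      unfolding set_integral_diff(2)[OF hi Fi] F0 I_def by simp
    also have "\<bar>\<dots>\<bar> \<le> (LINT z:B|lebesgue. \<bar>(w z * pd None \<psi> z + D z $ None * \<psi> z) - F z\<bar>)"
      unfolding set_lebesgue_integral_def
      by (rule order_trans[OF integral_abs_bound]) (simp add: abs_mult)
    also have "\<dots> \<le> (LINT z:B|lebesgue. M * (2 * \<delta>) + M / \<delta> * e k z)"
    proof (rule set_integral_mono)
      show "set_integrable lebesgue B (\<lambda>z. \<bar>(w z * pd None \<psi> z + D z $ None * \<psi> z) - F z\<bar>)"
        by (intro set_integrable_abs set_integral_diff(1) hi Fi)
      show "set_integrable lebesgue B (\<lambda>z. M * (2 * \<delta>) + M / \<delta> * e k z)"
        by (intro set_integral_add(1) one set_integrable_mult_right ei)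
      fix z assume z: "z \<in> B"
      have "\<bar>D z $ None - pd None (\<phi> k) z\<bar> \<le> norm (D z - grad (\<phi> k) z)"
        using component_le_norm_cart[of "D z - grad (\<phi> k) z" None] by (simp add: grad_def)
      also have "\<dots> \<le> \<delta> + (norm (D z - grad (\<phi> k) z))\<^sup>2 / \<delta>"
        using le_add_square_div[OF that, of "norm (D z - grad (\<phi> k) z)"] by simp
      finally have "\<bar>w z - \<phi> k z\<bar> + \<bar>D z $ None - pd None (\<phi> k) z\<bar> \<le> 2 * \<delta> + e k z / \<delta>"
        using le_add_square_div[OF that, of "w z - \<phi> k z"] by (simp add: e_def add_divide_distrib)
      then have "M * (\<bar>w z - \<phi> k z\<bar> + \<bar>D z $ None - pd None (\<phi> k) z\<bar>) \<le> M * (2 * \<delta> + e k z / \<delta>)"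
        using M0 by (intro mult_left_mono) auto
      moreover have "\<bar>(w z * pd None \<psi> z + D z $ None * \<psi> z) - F z\<bar>
        \<le> \<bar>(w z - \<phi> k z) * pd None \<psi> z\<bar> + \<bar>(D z $ None - pd None (\<phi> k) z) * \<psi> z\<bar>"
        by (rule order_trans[OF _ abs_triangle_ineq]) (simp add: F_def algebra_simps)
      moreover have "\<bar>(w z - \<phi> k z) * pd None \<psi> z\<bar> \<le> \<bar>w z - \<phi> k z\<bar> * M"
        "\<bar>(D z $ None - pd None (\<phi> k) z) * \<psi> z\<bar> \<le> \<bar>D z $ None - pd None (\<phi> k) z\<bar> * M"
        unfolding abs_mult using M1[OF z] by (auto intro!: mult_left_mono)
      ultimately show "\<bar>(w z * pd None \<psi> z + D z $ None * \<psi> z) - F z\<bar> \<le> M * (2 * \<delta>) + M / \<delta> * e k z"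
        by (simp add: algebra_simps)
    qed
    also have "\<dots> = M * (2 * \<delta> * m) + M / \<delta> * (LINT z:B|lebesgue. e k z)"
    proof -
      have "(LINT z:B|lebesgue. M * (2 * \<delta>)) = M * (2 * \<delta>) * m"
        using mB by (simp add: set_lebesgue_integral_def m_def)
      then show ?thesis
        by (subst set_integral_add(2)) (auto intro!: one ei set_integrable_mult_right simp del: divide_inverse)
    qed
    finally show ?thesis .
  qed
  have est2: "\<bar>I\<bar> \<le> M * (2 * \<delta> * m)" if "\<delta> > 0" for \<delta>
  proof -
    have "(\<lambda>k. M * (2 * \<delta> * m) + M / \<delta> * (LINT z:B|lebesgue. e k z)) \<longlonglongrightarrow> M * (2 * \<delta> * m) + M / \<delta> * 0"
      using lim unfolding e_def B_def by (intro tendsto_intros)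
    then show ?thesis
      using est[OF that] by (intro LIMSEQ_le_const[where a="\<bar>I\<bar>"]) auto
  qed
  have "I = 0"
  proof (rule ccontr)
    assume "I \<noteq> 0"
    \<comment> \<open>For \<delta> = |I| / c the bound \<open>est2\<close> reads |I| \<le> (c - 1) /
      c * |I|, which is impossible for nonzero I.\<close>
    define c where "c = 2 * M * m + 1"
    have c: "c > 0" using M0 by (simp add: c_def m_def add_nonneg_pos)
    have "\<bar>I\<bar> \<le> (c - 1) * (\<bar>I\<bar> / c)"
      using est2[of "\<bar>I\<bar> / c"] c \<open>I \<noteq> 0\<close> by (simp add: c_def mult_ac)
    then have "\<bar>I\<bar> * c \<le> (c - 1) * \<bar>I\<bar>" using c by (simp add: pos_le_divide_eq)
    then show False using \<open>I \<noteq> 0\<close> by (simp add: algebra_simps)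
  qed
  then show "(LINT z:half_ball r|lebesgue. w z * pd None \<psi> z) = - (LINT z:half_ball r|lebesgue. D z $ None * \<psi> z)"
    using I by (simp add: B_def)
qed

section \<open>Decay of averages over thin slabs\<close>

text \<open>The horizontal part stays a vector of the full space, so that horizontal translation is
  ordinary addition and no second vector type is needed.\<close>

definition hz :: "real^('n::finite option) \<Rightarrow> real^('n option)" where
  "hz z = z - ht z *\<^sub>R axis None 1"

lemma hz_nth: "hz z $ i = (if i = None then 0 else z $ i)"
  by (simp add: hz_def ht_def axis_def)

lemma ht_simps [simp]:
  "ht (z + z') = ht z + ht z'" "ht (z - z') = ht z - ht z'" "ht (c *\<^sub>R z) = c * ht z"
  "ht (hz z) = 0" "ht 0 = 0" "ht 1 = 1" "ht (axis i 1) = (if i = None then 1 else 0)"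
  by (auto simp: ht_def hz_nth axis_def)

lemma hz_simps [simp]: "hz (axis None 1) = 0"
  by (simp add: vec_eq_iff hz_nth axis_def)

lemma bounded_linear_hz: "bounded_linear hz"
  unfolding hz_def ht_def
  by (intro bounded_linear_sub bounded_linear_ident bounded_linear_compose[OF bounded_linear_scaleR_left] bounded_linear_vec_nth)

lemma continuous_on_ht [continuous_intros]: "continuous_on S f \<Longrightarrow> continuous_on S (\<lambda>x. ht (f x))"
  unfolding ht_def by (intro continuous_intros)

lemma continuous_on_hz [continuous_intros]: "continuous_on S f \<Longrightarrow> continuous_on S (\<lambda>x. hz (f x))"
  unfolding hz_def by (intro continuous_intros)

lemma hz_decomp: "z = hz z + ht z *\<^sub>R axis None 1"
  by (simp add: hz_def)

lemma hz_lin: "hz (z + z') = hz z + hz z'" "hz (z - z') = hz z - hz z'" "hz (c *\<^sub>R z) = c *\<^sub>R hz z"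
  by (auto simp: vec_eq_iff hz_nth)

lemma norm_hz_le: "norm (hz z) \<le> norm z" and norm_ht_le: "\<bar>ht z\<bar> \<le> norm z"
proof -
  show "norm (hz z) \<le> norm z"
    by (rule norm_le_componentwise_cart) (simp add: hz_nth)
  show "\<bar>ht z\<bar> \<le> norm z"
    unfolding ht_def by (rule component_le_norm_cart)
qed

section \<open>Test functions concentrated on thin slabs\<close>

lemma DERIV_max_0_square: "DERIV (\<lambda>t. (max 0 t)\<^sup>2) t :> 2 * max 0 (t::real)"
proof -
  consider "t < 0" | "t = 0" | "t > 0" by linarith
  then show ?thesis
  proof cases
    case 1
    show ?thesis
      by (rule has_field_derivative_transform_within_open[where f="\<lambda>_. 0" and S="{..<0}"])
        (use 1 in auto)
  next
    case 2
    have "((\<lambda>h::real. max 0 h) \<longlongrightarrow> max 0 0) (at 0)"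
      by (intro tendsto_intros)
    moreover have "(max 0 (0 + h))\<^sup>2 / h = max 0 h" if "h \<noteq> 0" for h :: real
      using that by (auto simp: max_def power2_eq_square)
    ultimately have "((\<lambda>h::real. ((max 0 (0 + h))\<^sup>2 - (max 0 0)\<^sup>2) / h) \<longlongrightarrow> 0) (at 0)"
      by (subst tendsto_cong[of _ "\<lambda>h. max 0 h"]) (auto simp: eventually_at_filter)
    then show ?thesis using 2 by (simp add: DERIV_def)
  next
    case 3
    show ?thesis
      by (rule has_field_derivative_transform_within_open[where f="\<lambda>t. t\<^sup>2" and S="{0<..}"])
        (use 3 in \<open>auto intro!: derivative_eq_intros simp: max_def\<close>)
  qed
qed

text \<open>A cut-off in x alone, to the ball of radius \<rho> about the horizontal part of c.
  Squaring the positive part makes it differentiable across the edge of the ball.\<close>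

definition bump :: "real^('n::finite option) \<Rightarrow> real \<Rightarrow> real^('n option) \<Rightarrow> real" where
  "bump c \<rho> z = (max 0 (\<rho>\<^sup>2 - hz (z - c) \<bullet> hz (z - c)))\<^sup>2"

lemma bump_differentiable: "bump c \<rho> differentiable at z"
  and pd_bump: "pd None (bump c \<rho>) z = 0"
  and continuous_on_bump: "continuous_on S (bump c \<rho>)"
proof -
  let ?f = "\<lambda>z. \<rho>\<^sup>2 - hz (z - c) \<bullet> hz (z - c)"
  have "((\<lambda>z. hz (z - c)) has_derivative (\<lambda>h. hz h)) (at z)"
    by (rule bounded_linear.has_derivative[OF bounded_linear_hz]) (auto intro!: derivative_eq_intros)
  then have d: "(?f has_derivative (\<lambda>h. - (hz (z - c) \<bullet> hz h + hz h \<bullet> hz (z - c)))) (at z)"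
    by (auto intro!: derivative_eq_intros)
  then have f: "?f differentiable at z" "pd None ?f z = 0"
    by (auto simp: differentiable_def pd_eqI)
  show "bump c \<rho> differentiable at z" "pd None (bump c \<rho>) z = 0"
    using pd_compose(1)[OF f(1) DERIV_max_0_square, of None] pd_compose(2)[OF f(1) DERIV_max_0_square] f(2) by (simp_all add: bump_def[abs_def])
  show "continuous_on S (bump c \<rho>)"
    unfolding bump_def[abs_def] by (intro continuous_intros)
qed

lemma bump_nonneg: "bump c \<rho> z \<ge> 0"
  by (simp add: bump_def)

lemma bump_le: "\<rho> > 0 \<Longrightarrow> bump c \<rho> z \<le> \<rho> ^ 4"
proof -
  have "bump c \<rho> z \<le> (\<rho>\<^sup>2)\<^sup>2"
    unfolding bump_def by (intro power_mono) auto
  then show ?thesis by (simp add: power_mult[symmetric])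
qed

lemma bump_pos: "norm (hz (z - c)) \<le> \<rho> / 2 \<Longrightarrow> \<rho> ^ 4 / 4 \<le> bump c \<rho> z"
proof -
  assume a: "norm (hz (z - c)) \<le> \<rho> / 2"
  then have "hz (z - c) \<bullet> hz (z - c) \<le> (\<rho> / 2)\<^sup>2"
    unfolding power2_norm_eq_inner[symmetric] by (intro power_mono) auto
  then have "\<rho>\<^sup>2 / 2 \<le> \<rho>\<^sup>2 - hz (z - c) \<bullet> hz (z - c)"
    using zero_le_power2[of \<rho>] inner_ge_zero[of "hz (z - c)"] unfolding power_divide
    by (simp only: power2_eq_square)
  then have "(\<rho>\<^sup>2 / 2)\<^sup>2 \<le> bump c \<rho> z"
    unfolding bump_def by (intro power_mono order_trans[OF _ max.cobounded2]) auto
  then show ?thesis by (simp add: power_divide power_mult[symmetric])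
qed

lemma bump_eq_0: "0 \<le> \<rho> \<Longrightarrow> \<rho> \<le> norm (hz (z - c)) \<Longrightarrow> bump c \<rho> z = 0"
  using power_mono[of \<rho> "norm (hz (z - c))" 2]
  by (simp add: bump_def power2_norm_eq_inner)

text \<open>Up to the factor -2 / \<epsilon> this is the y-derivative of the test function with
  squared profile, \<open>bump c \<rho> z * (max 0 (3 - ht z / \<epsilon>))\<^sup>2\<close>. The
  number 3 makes the profile at least 1 up to height 2 \<epsilon>.\<close>

definition slab :: "real^('n::finite option) \<Rightarrow> real \<Rightarrow> real \<Rightarrow> real^('n option) \<Rightarrow> real" where
  "slab c \<rho> \<epsilon> z = bump c \<rho> z * max 0 (3 - ht z / \<epsilon>)"

text \<open>Integration by parts against \<open>\<psi> k\<close> turns the slab integral of w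
  divided by \<open>\<epsilon> k\<close> into half the integral of the y-derivative of w times
  \<open>\<psi> k\<close>. The functions \<open>\<psi> k\<close> are uniformly bounded and their
  supports shrink to y = 0, so dominated convergence gives the limit 0.\<close>

lemma zero_trace_slab:
  fixes w :: "real^('n::finite option) \<Rightarrow> real" and c :: "real^('n option)"
  assumes w: "w \<in> H10_tilde" and \<rho>: "\<rho> > 0"
    and \<epsilon>: "\<And>k. 0 < \<epsilon> k" "\<And>k. \<epsilon> k \<le> 1" "\<epsilon> \<longlonglongrightarrow> 0"
  defines "r \<equiv> norm c + \<rho> + 4"
  shows "set_integrable lebesgue (half_ball r) (\<lambda>z. w z * slab c \<rho> (\<epsilon> k) z)"
    and "(\<lambda>k. (LINT z:half_ball r|lebesgue. w z * slab c \<rho> (\<epsilon> k) z) / \<epsilon> k) \<longlonglongrightarrow> 0"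
proof -
  have r0: "r > 0" using \<rho> by (simp add: r_def add_nonneg_pos)
  from w obtain D where D0: "has_weak_gradient half_space w D" and "\<forall>r>0.
        set_integrable lebesgue (half_ball r) (\<lambda>z. (norm (D z))\<^sup>2 + (w z)\<^sup>2) \<and>
        (\<exists>\<phi> :: nat \<Rightarrow> real^('n option) \<Rightarrow> real.
           (\<forall>k. C1c (closure (half_ball r) - {z. ht z = 0}) (\<phi> k)) \<and>
           (\<lambda>k. LINT z:half_ball r|lebesgue.
                  (norm (D z - grad (\<phi> k) z))\<^sup>2 + \<bar>w z - \<phi> k z\<bar>\<^sup>2) \<longlonglongrightarrow> 0)"
    unfolding H10_tilde_def mem_Collect_eq by (elim exE conjE)
  from this(2)[rule_format, OF r0] obtain \<phi> where D1:
      "set_integrable lebesgue (half_ball r) (\<lambda>z. (norm (D z))\<^sup>2 + (w z)\<^sup>2)"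
      "\<And>k :: nat. C1c (closure (half_ball r) - {z. ht z = 0}) (\<phi> k)"
      "(\<lambda>k. LINT z:half_ball r|lebesgue. (norm (D z - grad (\<phi> k) z))\<^sup>2 + \<bar>w z - \<phi> k z\<bar>\<^sup>2) \<longlonglongrightarrow> 0"
    by (elim exE conjE) (rule that, assumption, erule spec, assumption)
  note D = D0 D1
  define B :: "(real^('n option)) set" where "B = half_ball r"
  define \<psi> where "\<psi> k z = bump c \<rho> z * (max 0 (3 - ht z / \<epsilon> k))\<^sup>2" for k z
  have h: "(\<lambda>z. 3 - ht z / \<epsilon> k) differentiable at z" "pd None (\<lambda>z. 3 - ht z / \<epsilon> k) z = - 1 / \<epsilon> k"
    for k and z :: "real^('n option)"
  proof -
    have "((\<lambda>z. 3 - ht z / \<epsilon> k) has_derivative (\<lambda>h. - (ht h / \<epsilon> k))) (at z)"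
      unfolding ht_def using \<epsilon>(1)[of k]
      by (auto intro!: derivative_eq_intros bounded_linear_imp_has_derivative[OF bounded_linear_vec_nth])
    then show "(\<lambda>z. 3 - ht z / \<epsilon> k) differentiable at z" "pd None (\<lambda>z. 3 - ht z / \<epsilon> k) z = - 1 / \<epsilon> k"
      by (auto simp: differentiable_def pd_eqI)
  qed
  note m = pd_compose[OF h(1) DERIV_max_0_square]
  have \<psi>d: "\<psi> k differentiable at z" for k z
    unfolding \<psi>_def[abs_def] by (intro differentiable_mult bump_differentiable m(2))
  have \<psi>pd: "pd None (\<psi> k) z = - (2 / \<epsilon> k) * slab c \<rho> (\<epsilon> k) z" for k z
    unfolding \<psi>_def[abs_def] by (subst pd_mult[OF bump_differentiable m(2)]) (simp add: pd_bump m(1) h(2) slab_def)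
  have \<psi>c: "continuous_on UNIV (pd None (\<psi> k))" for k
    unfolding \<psi>pd[abs_def] slab_def divide_inverse
    by (intro continuous_intros continuous_on_bump)
  have hdB: "ht z > 0" if "z \<in> B" for z using that by (simp add: B_def half_ball_def half_space_def)
  \<comment> \<open>On the support the horizontal distance from c is below \<rho> and the height
    below 3 \<open>\<epsilon> k\<close> \<le> 3, so the norm is below norm c + \<rho> + 3 = r -
    1.\<close>
  have \<psi>0: "\<psi> k z = 0" if z: "z \<in> half_ball r" "norm z > r - 1" for k z
  proof (rule ccontr)
    assume "\<psi> k z \<noteq> 0"
    then have "bump c \<rho> z \<noteq> 0" and "max 0 (3 - ht z / \<epsilon> k) \<noteq> 0" by (auto simp: \<psi>_def)
    then have "norm (hz (z - c)) < \<rho>" "3 - ht z / \<epsilon> k > 0"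
      using bump_eq_0[of \<rho> z c] \<rho> by (force simp: max_def split: if_splits)+
    moreover from this(2) have "ht z < 3"
      using \<epsilon>(1,2)[of k] by (simp add: field_simps)
    moreover have "norm z \<le> norm (hz (z - c)) + norm (hz c) + \<bar>ht z\<bar>"
    proof -
      have "z = hz (z - c) + hz c + ht z *\<^sub>R axis None 1"
        by (simp add: hz_lin flip: hz_decomp)
      then have "norm z = norm (hz (z - c) + hz c + ht z *\<^sub>R axis None 1)" by simp
      also have "\<dots> \<le> norm (hz (z - c)) + norm (hz c) + norm (ht z *\<^sub>R (axis None 1 :: real^('n option)))"
        by (intro order_trans[OF norm_triangle_ineq] add_right_mono norm_triangle_ineq)
      finally show ?thesis by simp
    qed
    moreover have "ht z > 0" using z by (intro hdB) (simp add: B_def)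
    ultimately show False
      using z(2) norm_hz_le[of c] by (simp add: r_def)
  qed
  have rr: "r - 1 < r" by simp
  have Di: "set_integrable lebesgue B (\<lambda>z. norm (D z))"
    unfolding B_def by (rule zero_trace_parts(1)[OF D \<psi>d \<psi>c rr \<psi>0])
  have wi: "set_integrable lebesgue B (\<lambda>z. w z * (- (2 / \<epsilon> k) * slab c \<rho> (\<epsilon> k) z))" for k
    unfolding B_def \<psi>pd[symmetric] by (rule zero_trace_parts(2)[OF D \<psi>d \<psi>c rr \<psi>0])
  have eq: "(LINT z:B|lebesgue. w z * (- (2 / \<epsilon> k) * slab c \<rho> (\<epsilon> k) z)) = - (LINT z:B|lebesgue. D z $ None * \<psi> k z)" for k
    unfolding B_def \<psi>pd[symmetric] by (rule zero_trace_parts(3)[OF D \<psi>d \<psi>c rr \<psi>0])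
  have "set_integrable lebesgue B (\<lambda>z. (- (\<epsilon> k / 2)) * (w z * (- (2 / \<epsilon> k) * slab c \<rho> (\<epsilon> k) z)))"
    by (intro set_integrable_mult_right wi)
  then show "set_integrable lebesgue (half_ball r) (\<lambda>z. w z * slab c \<rho> (\<epsilon> k) z)"
    using \<epsilon>(1)[of k] by (simp add: B_def)
  define E where "E k = (LINT z:B|lebesgue. norm (D z) * indicat_real {z. ht z < 3 * \<epsilon> k} z)" for k
  have E: "E \<longlonglongrightarrow> (LINT z::real^('n option)|lebesgue. 0)"
    unfolding E_def set_lebesgue_integral_def
  proof (rule integral_dominated_convergence)
    show "integrable lebesgue (\<lambda>z. indicat_real B z *\<^sub>R norm (D z))"
      using Di by (simp add: set_integrable_def)
    have "{z :: real^('n option). ht z < 3 * \<epsilon> k} \<in> sets borel" for k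
      unfolding ht_def by (intro borel_open open_Collect_less continuous_intros)
    then have "indicat_real {z :: real^('n option). ht z < 3 * \<epsilon> k} \<in> borel_measurable lebesgue" for k
      by (intro borel_measurable_indicator) simp
    moreover have "(\<lambda>z. indicat_real B z *\<^sub>R norm (D z)) \<in> borel_measurable lebesgue"
      using Di unfolding set_integrable_def by (rule borel_measurable_integrable)
    ultimately have "(\<lambda>z. (indicat_real B z *\<^sub>R norm (D z)) * indicat_real {z. ht z < 3 * \<epsilon> k} z) \<in> borel_measurable lebesgue" for k
      by (intro borel_measurable_times)
    then show "(\<lambda>z. indicat_real B z *\<^sub>R (norm (D z) * indicat_real {z. ht z < 3 * \<epsilon> k} z)) \<in> borel_measurable lebesgue" for k
      by (simp add: mult.assoc)
    show "AE z in lebesgue. (\<lambda>k. indicat_real B z *\<^sub>R (norm (D z) * indicat_real {z. ht z < 3 * \<epsilon> k} z)) \<longlonglongrightarrow> 0"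
    proof (rule AE_I2)
      fix z :: "real^('n option)"
      show "(\<lambda>k. indicat_real B z *\<^sub>R (norm (D z) * indicat_real {z. ht z < 3 * \<epsilon> k} z)) \<longlonglongrightarrow> 0"
      proof (cases "z \<in> B")
        case True
        have "(\<lambda>k. 3 * \<epsilon> k) \<longlonglongrightarrow> 3 * 0" using \<epsilon>(3) by (intro tendsto_intros)
        then have "eventually (\<lambda>k. 3 * \<epsilon> k < ht z) sequentially"
          using hdB[OF True] by (intro order_tendstoD) auto
        then show ?thesis
          by (intro tendsto_eventually) (erule eventually_mono, auto simp: indicator_def)
      qed simp
    qed
    show "AE z in lebesgue. norm (indicat_real B z *\<^sub>R (norm (D z) * indicat_real {z. ht z < 3 * \<epsilon> k} z)) \<le> indicat_real B z *\<^sub>R norm (D z)" for k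
      by (rule AE_I2) (auto simp: indicator_def)
  qed auto
  \<comment> \<open>The constant 9 \<rho>^4 bounds \<open>\<psi> k\<close>: the bump is at most
    \<rho>^4 and the profile at most 3 before squaring. The 2 in the denominator comes from
    differentiating the square.\<close>
  have bound: "\<bar>(LINT z:B|lebesgue. w z * slab c \<rho> (\<epsilon> k) z) / \<epsilon> k\<bar> \<le> 9 * \<rho> ^ 4 / 2 * E k" for k
  proof -
    have i0: "set_integrable lebesgue B (\<lambda>z. w z * (- (2 / \<epsilon> k) * slab c \<rho> (\<epsilon> k) z))" by (rule wi)
    have "(LINT z:B|lebesgue. w z * (- (2 / \<epsilon> k) * slab c \<rho> (\<epsilon> k) z)) = (LINT z:B|lebesgue. - (2 / \<epsilon> k) * (w z * slab c \<rho> (\<epsilon> k) z))"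
      by (simp add: mult_ac)
    also have "\<dots> = - (2 / \<epsilon> k) * (LINT z:B|lebesgue. w z * slab c \<rho> (\<epsilon> k) z)"
      by (rule set_integral_mult_right)
    finally have "- (2 / \<epsilon> k) * (LINT z:B|lebesgue. w z * slab c \<rho> (\<epsilon> k) z) = - (LINT z:B|lebesgue. D z $ None * \<psi> k z)"
      unfolding eq by simp
    then have "(LINT z:B|lebesgue. w z * slab c \<rho> (\<epsilon> k) z) / \<epsilon> k = (LINT z:B|lebesgue. D z $ None * \<psi> k z) / 2"
      by (simp add: mult.commute)
    then have "\<bar>(LINT z:B|lebesgue. w z * slab c \<rho> (\<epsilon> k) z) / \<epsilon> k\<bar> = \<bar>LINT z:B|lebesgue. D z $ None * \<psi> k z\<bar> / 2"
      by (simp only: abs_divide abs_numeral)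
    also have "\<bar>LINT z:B|lebesgue. D z $ None * \<psi> k z\<bar> \<le> (LINT z:B|lebesgue. (9 * \<rho> ^ 4) * (norm (D z) * indicat_real {z. ht z < 3 * \<epsilon> k} z))"
      unfolding set_lebesgue_integral_def
    proof (rule order_trans[OF integral_abs_bound integral_mono'])
      have "set_borel_measurable lebesgue B (\<lambda>z. norm (D z) * indicat_real {z. ht z < 3 * \<epsilon> k} z)"
      proof -
        have "{z :: real^('n option). ht z < 3 * \<epsilon> k} \<in> sets borel"
          unfolding ht_def by (intro borel_open open_Collect_less continuous_intros)
        then have "indicat_real {z :: real^('n option). ht z < 3 * \<epsilon> k} \<in> borel_measurable lebesgue"
          by (intro borel_measurable_indicator) simp
        moreover have "(\<lambda>z. indicat_real B z *\<^sub>R norm (D z)) \<in> borel_measurable lebesgue"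
          using Di unfolding set_integrable_def by (rule borel_measurable_integrable)
        ultimately have "(\<lambda>z. (indicat_real B z *\<^sub>R norm (D z)) * indicat_real {z. ht z < 3 * \<epsilon> k} z) \<in> borel_measurable lebesgue"
          by (intro borel_measurable_times)
        then show ?thesis by (simp add: set_borel_measurable_def mult.assoc)
      qed
      then have "set_integrable lebesgue B (\<lambda>z. norm (D z) * indicat_real {z. ht z < 3 * \<epsilon> k} z)"
        by (rule set_integrable_bound[OF Di]) (auto simp: indicator_def)
      then have "set_integrable lebesgue B (\<lambda>z. (9 * \<rho> ^ 4) * (norm (D z) * indicat_real {z. ht z < 3 * \<epsilon> k} z))"
        by (intro set_integrable_mult_right)
      then show "integrable lebesgue (\<lambda>z. indicat_real B z *\<^sub>R ((9 * \<rho> ^ 4) * (norm (D z) * indicat_real {z. ht z < 3 * \<epsilon> k} z)))"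
        by (simp only: set_integrable_def)
      fix z :: "real^('n option)"
      show "\<bar>indicat_real B z *\<^sub>R (D z $ None * \<psi> k z)\<bar> \<le> indicat_real B z *\<^sub>R ((9 * \<rho> ^ 4) * (norm (D z) * indicat_real {z. ht z < 3 * \<epsilon> k} z))"
      proof (cases "z \<in> B \<and> ht z < 3 * \<epsilon> k")
        case True
        have "max 0 (3 - ht z / \<epsilon> k) \<le> 3" using hdB[of z] True \<epsilon>(1)[of k] by simp
        then have "(max 0 (3 - ht z / \<epsilon> k))\<^sup>2 \<le> 3\<^sup>2" by (intro power_mono) auto
        then have "\<bar>\<psi> k z\<bar> \<le> \<rho> ^ 4 * 3\<^sup>2"
          unfolding \<psi>_def abs_mult using bump_le[OF \<rho>, of c z] bump_nonneg[of c \<rho> z]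
          by (intro mult_mono) auto
        then have "\<bar>D z $ None\<bar> * \<bar>\<psi> k z\<bar> \<le> norm (D z) * (\<rho> ^ 4 * 3\<^sup>2)"
          by (intro mult_mono component_le_norm_cart) auto
        then show ?thesis using True by (simp add: abs_mult mult_ac)
      next
        case False
        then have "\<psi> k z = 0" if "z \<in> B"
          using that \<epsilon>(1)[of k] by (simp add: \<psi>_def field_simps max_def)
        with False show ?thesis by (auto simp: indicator_def)
      qed
    qed simp
    also have "(LINT z:B|lebesgue. (9 * \<rho> ^ 4) * (norm (D z) * indicat_real {z. ht z < 3 * \<epsilon> k} z)) = (9 * \<rho> ^ 4) * E k"
      unfolding E_def by (rule set_integral_mult_right)
    finally show ?thesis by simp
  qed
  have "(\<lambda>k. 9 * \<rho> ^ 4 / 2 * E k) \<longlonglongrightarrow> 9 * \<rho> ^ 4 / 2 * 0"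
    using E by (intro tendsto_intros) simp
  then have "(\<lambda>k. 9 * \<rho> ^ 4 / 2 * E k) \<longlonglongrightarrow> 0" by simp
  then have "(\<lambda>k. (LINT z:B|lebesgue. w z * slab c \<rho> (\<epsilon> k) z) / \<epsilon> k) \<longlonglongrightarrow> 0"
    by (rule Lim_null_comparison[rotated]) (simp only: real_norm_def bound eventually_True)
  then show "(\<lambda>k. (LINT z:half_ball r|lebesgue. w z * slab c \<rho> (\<epsilon> k) z) / \<epsilon> k) \<longlonglongrightarrow> 0"
    by (simp add: B_def)
qed

lemma hz_0 [simp]: "hz 0 = 0"
  by (simp add: vec_eq_iff hz_nth)

lemma content_unit_cbox: "measure lborel (cbox 0 (1 :: real^'m::finite)) = 1"
proof -
  have "(0 :: real^'m) \<in> cbox 0 1" by (simp add: mem_box_cart)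
  then show ?thesis by (subst content_cbox_cart) auto
qed

text \<open>On the box with base of side d and heights between \<epsilon> and 2 \<epsilon>,
  \<open>slab\<close> is at least \<rho>^4 / 4, by \<open>bump_pos\<close> and the choice of
  profile. Writing the box as an affine image of the unit cube gives the Jacobian \<epsilon> d^n.
  The free parameters allow both uses: a small box below a point for 1 - U, and boxes with unit base
  for U - 1.\<close>

lemma slab_box_le:
  fixes b c :: "real^('n::finite option)"
  assumes \<rho>: "\<rho> > 0" and \<epsilon>: "0 < \<epsilon>" "\<epsilon> \<le> 1" and d: "d > 0"
    and box: "\<And>p. p \<in> cbox 0 1 \<Longrightarrow> norm (hz (b - c) + d *\<^sub>R hz p) \<le> \<rho> / 2"
    and g: "continuous_on half_space g"
    and gi: "set_integrable lebesgue (half_ball (norm c + \<rho> + 4)) (\<lambda>z. g z * slab c \<rho> \<epsilon> z)"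
    and g0: "\<And>z. z \<in> half_ball (norm c + \<rho> + 4) \<Longrightarrow> 0 \<le> g z * slab c \<rho> \<epsilon> z"
  shows "\<epsilon> * d ^ CARD('n) * (\<rho> ^ 4 / 4) *
      integral (cbox 0 1) (\<lambda>p. g (hz b + d *\<^sub>R hz p + (\<epsilon> + \<epsilon> * ht p) *\<^sub>R axis None 1))
    \<le> (LINT z:half_ball (norm c + \<rho> + 4)|lebesgue. g z * slab c \<rho> \<epsilon> z)"
proof -
  define B :: "(real^('n option)) set" where "B = half_ball (norm c + \<rho> + 4)"
  define e :: "real^('n option)" where "e = axis None 1"
  define T where "T p = hz b + d *\<^sub>R hz p + (\<epsilon> + \<epsilon> * ht p) *\<^sub>R e" for p
  define lo where "lo = hz b + \<epsilon> *\<^sub>R e"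
  define m where "m k = (if k = None then \<epsilon> else d)" for k :: "'n option"
  define hi where "hi = lo + (\<chi> k. m k)"
  have m0: "m k > 0" for k using \<epsilon> d by (simp add: m_def)
  have T: "T p = (\<chi> k. m k * p $ k) + lo" for p
    by (auto simp: vec_eq_iff T_def lo_def m_def hz_nth e_def axis_def ht_def)
  have "(\<Prod>k\<in>UNIV. m k) = \<epsilon> * d ^ CARD('n)"
    by (simp add: UNIV_option_conv m_def prod.reindex)
  then have pm: "\<bar>prod m UNIV\<bar> = \<epsilon> * d ^ CARD('n)" using \<epsilon> d by simp
  have mem: "\<exists>p\<in>cbox 0 1. z = T p" if "z \<in> cbox lo hi" for z
  proof
    define p where "p = (\<chi> k. (z - lo) $ k / m k)"
    show "z = T p" using m0 by (simp add: T p_def vec_eq_iff less_imp_neq[THEN not_sym])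
    show "p \<in> cbox 0 1"
      using that by (auto simp: p_def mem_box_cart hi_def pos_le_divide_eq[OF m0] pos_divide_le_eq[OF m0] algebra_simps)
  qed
  have TB: "T p \<in> B" "slab c \<rho> \<epsilon> (T p) \<ge> \<rho> ^ 4 / 4" if p: "p \<in> cbox 0 1" for p
  proof -
    have hp: "0 \<le> ht p" "ht p \<le> 1" using p by (auto simp: mem_box_cart ht_def)
    have ht: "ht (T p) = \<epsilon> + \<epsilon> * ht p" by (simp add: T_def e_def)
    have "hz (hz x) = hz x" for x :: "real^('n option)" by (simp add: vec_eq_iff hz_nth)
    then have hzT: "hz (T p) = hz b + d *\<^sub>R hz p" by (simp add: T_def hz_lin e_def)
    then have hzc: "norm (hz (T p - c)) \<le> \<rho> / 2" using box[OF p] by (simp add: hz_lin algebra_simps)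
    have "\<epsilon> * ht p \<le> \<epsilon> * 1" using hp \<epsilon> by (intro mult_left_mono) auto
    then have ht2: "0 < ht (T p)" "ht (T p) \<le> 2 * \<epsilon>"
      using hp \<epsilon> by (auto simp: ht add_pos_nonneg)
    have "T p = hz (T p - c) + hz c + ht (T p) *\<^sub>R e"
      unfolding e_def hz_lin by (simp flip: hz_decomp)
    then have "norm (T p) = norm (hz (T p - c) + hz c + ht (T p) *\<^sub>R e)" by simp
    also have "\<dots> \<le> norm (hz (T p - c)) + norm (hz c) + norm (ht (T p) *\<^sub>R e)"
      by (intro order_trans[OF norm_triangle_ineq] add_right_mono norm_triangle_ineq)
    also have "norm (ht (T p) *\<^sub>R e) = ht (T p)" using ht2 by (simp add: e_def)
    finally have "norm (T p) < norm c + \<rho> + 4"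
      using hzc norm_hz_le[of c] ht2 \<epsilon> \<rho> by linarith
    then show "T p \<in> B" using ht2 by (simp add: B_def half_ball_def half_space_def)
    have "1 \<le> max 0 (3 - ht (T p) / \<epsilon>)" using ht2 \<epsilon> by (simp add: le_max_iff_disj field_simps)
    then have "\<rho> ^ 4 / 4 * 1 \<le> slab c \<rho> \<epsilon> (T p)"
      unfolding slab_def using bump_pos[OF hzc] by (intro mult_mono bump_nonneg) auto
    then show "slab c \<rho> \<epsilon> (T p) \<ge> \<rho> ^ 4 / 4" by simp
  qed
  have sub: "cbox lo hi \<subseteq> B" using mem TB(1) by blast
  have gc: "continuous_on (cbox lo hi) g"
    using sub half_ball_subset by (intro continuous_on_subset[OF g]) (auto simp: B_def)
  have slabc: "continuous_on S (slab c \<rho> \<epsilon>)" for S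
    unfolding slab_def[abs_def] divide_inverse by (intro continuous_intros continuous_on_bump)
  define I where "I = integral (cbox lo hi) g"
  have "(g has_integral I) (cbox lo hi)"
    unfolding I_def by (intro integrable_integral integrable_continuous gc)
  from has_integral_affinity'[OF this, of 1 lo]
  have "((\<lambda>x. g (x + lo)) has_integral I) (cbox 0 (\<chi> k. m k))"
    by (simp add: hi_def)
  from has_integral_stretch_cart[OF this, of m] m0
  have "((\<lambda>x. g (T x)) has_integral I /\<^sub>R (\<epsilon> * d ^ CARD('n))) ((\<lambda>x. \<chi> k. x $ k / m k) ` cbox 0 (\<chi> k. m k))"
    by (simp add: T pm less_imp_neq[THEN not_sym])
  moreover have "(\<lambda>x. \<chi> k. x $ k / m k) ` cbox 0 (\<chi> k. m k) = cbox 0 (1 :: real^('n option))"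
  proof (intro equalityI subsetI)
    fix x :: "real^('n option)" assume x: "x \<in> cbox 0 1"
    show "x \<in> (\<lambda>x. \<chi> k. x $ k / m k) ` cbox 0 (\<chi> k. m k)"
    proof (rule image_eqI[of _ _ "\<chi> k. m k * x $ k"])
      show "x = (\<chi> k. (\<chi> k. m k * x $ k) $ k / m k)"
        using m0 by (simp add: vec_eq_iff less_imp_neq[THEN not_sym])
      show "(\<chi> k. m k * x $ k) \<in> cbox 0 (\<chi> k. m k)"
        using x m0 by (auto simp: mem_box_cart less_imp_le mult_left_le)
    qed
  qed (use m0 in \<open>auto simp: mem_box_cart divide_le_eq less_imp_le\<close>)
  ultimately have "((\<lambda>x. g (T x)) has_integral I /\<^sub>R (\<epsilon> * d ^ CARD('n))) (cbox 0 1)" by simp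
  then have "integral (cbox 0 1) (\<lambda>p. g (T p)) = I /\<^sub>R (\<epsilon> * d ^ CARD('n))"
    by (rule integral_unique)
  then have "\<epsilon> * d ^ CARD('n) * integral (cbox 0 1) (\<lambda>p. g (T p)) = I"
    using \<epsilon> d by (simp add: field_simps)
  then have "\<epsilon> * d ^ CARD('n) * (\<rho> ^ 4 / 4) * integral (cbox 0 1) (\<lambda>p. g (T p)) = integral (cbox lo hi) (\<lambda>z. \<rho> ^ 4 / 4 * g z)"
    by (simp add: I_def mult_ac)
  also have "\<dots> \<le> integral (cbox lo hi) (\<lambda>z. g z * slab c \<rho> \<epsilon> z)"
  proof (rule integral_le)
    fix z assume z: "z \<in> cbox lo hi"
    have s: "slab c \<rho> \<epsilon> z \<ge> \<rho> ^ 4 / 4" using mem[OF z] TB(2) by blast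
    moreover have r4: "\<rho> ^ 4 / 4 > 0" using \<rho> by simp
    ultimately have "slab c \<rho> \<epsilon> z > 0" by linarith
    then have "0 \<le> g z" using g0[of z] z sub by (force simp: B_def zero_le_mult_iff)
    then show "\<rho> ^ 4 / 4 * g z \<le> g z * slab c \<rho> \<epsilon> z"
      using s by (subst mult.commute) (intro mult_left_mono)
  qed (intro integrable_continuous continuous_intros gc slabc)+
  also have "\<dots> \<le> integral B (\<lambda>z. g z * slab c \<rho> \<epsilon> z)"
  proof (rule integral_subset_le[OF sub])
    show "(\<lambda>z. g z * slab c \<rho> \<epsilon> z) integrable_on cbox lo hi"
      by (intro integrable_continuous continuous_intros gc slabc)
    show "(\<lambda>z. g z * slab c \<rho> \<epsilon> z) integrable_on B"
      using set_lebesgue_integral_eq_integral(1)[OF gi] by (simp add: B_def)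
  qed (use g0 in \<open>simp add: B_def\<close>)
  also have "\<dots> = (LINT z:B|lebesgue. g z * slab c \<rho> \<epsilon> z)"
    using set_lebesgue_integral_eq_integral(2)[OF gi] by (simp add: B_def)
  finally show ?thesis by (simp add: B_def T_def e_def)
qed

section \<open>Growth and monotonicity of the solution\<close>

text \<open>The geometric hypotheses after translation into calculus: a stands for n - s, the
  equation is the Laplace-Beltrami equation written out, and \<open>key\<close> is the curvature
  condition. No metric occurs from here until the final theorem.\<close>

locale flat_solution =
  fixes v :: "real^('n::finite option) \<Rightarrow> real" and a :: real
  assumes a: "- 1 \<le> a" "a < 0"
    and v_C2: "C2_on half_space v"
    and v_pos: "z \<in> half_space \<Longrightarrow> v z > 0"
    and v_eq: "z \<in> half_space \<Longrightarrow> (ht z)\<^sup>2 * (\<Sum>i\<in>UNIV. pd i (pd i v) z)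
      - (real CARD('n) - 1) * ht z * pd None v z + (real CARD('n) - a) * a * v z = 0"
    and key: "z \<in> half_space \<Longrightarrow> (\<Sum>i\<in>UNIV. (qd a v i z)\<^sup>2) \<le> - 2 * a * qd a v None z / ht z"
    and trace: "(\<lambda>z. 1 - v z / ht z powr a) \<in> H10_tilde"
begin

definition U :: "real^('n option) \<Rightarrow> real" where "U z = v z / ht z powr a"
definition L :: "real^('n option) \<Rightarrow> real" where "L z = ln (v z) - a * ln (ht z)"
definition e :: "real^('n option)" where "e = axis None 1"

lemma ht_e [simp]: "ht e = 1" and hz_e [simp]: "hz e = 0" and norm_e [simp]: "norm e = 1"
  by (simp_all add: e_def)

lemma half_space_iff: "z \<in> half_space \<longleftrightarrow> ht z > 0"
  by (simp add: half_space_def)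

lemmas v_diff = C2_onD[OF v_C2 open_half_space]

lemma U_eq: "z \<in> half_space \<Longrightarrow> U z = exp (L z)"
  using v_pos[of z] by (simp add: U_def L_def half_space_iff exp_diff powr_def)

lemma continuous_on_v: "continuous_on half_space v"
  using v_C2 by (auto simp: C2_on_def C1_on_def intro: differentiable_imp_continuous_on)

lemma continuous_on_U: "continuous_on half_space U"
  unfolding U_def[abs_def] by (intro continuous_intros continuous_on_v) (auto simp: half_space_iff)

lemma DERIV_L_line:
  assumes "z + t *\<^sub>R h \<in> half_space"
  shows "DERIV (\<lambda>t. L (z + t *\<^sub>R h)) t :> (\<Sum>i\<in>UNIV. qd a v i (z + t *\<^sub>R h) * h $ i)"
proof -
  let ?p = "z + t *\<^sub>R h"
  have pos: "v ?p > 0" "ht z + t * ht h > 0"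
    using v_pos[OF assms] assms by (auto simp: half_space_iff)
  have "DERIV (\<lambda>t. L (z + t *\<^sub>R h)) t :> (\<Sum>i\<in>UNIV. pd i v ?p * h $ i) / v ?p - a * (ht h / (ht z + t * ht h))"
    unfolding L_def using pos
    by (auto intro!: derivative_eq_intros has_pd_line[OF v_diff(1)[OF assms]] simp: divide_inverse)
  also have "(\<Sum>i\<in>UNIV. pd i v ?p * h $ i) / v ?p - a * (ht h / (ht z + t * ht h)) = (\<Sum>i\<in>UNIV. qd a v i ?p * h $ i)"
  proof -
    have "qd a v i ?p * h $ i = pd i v ?p * h $ i / v ?p - (if i = None then a * (h $ i / ht ?p) else 0)" for i
      by (auto simp: qd_def algebra_simps)
    then show ?thesis by (simp add: sum_subtractf sum_divide_distrib ht_def)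
  qed
  finally show ?thesis .
qed

lemma qd_None_nonneg:
  assumes "z \<in> half_space"
  shows "0 \<le> qd a v None z"
proof -
  have "0 \<le> (\<Sum>i\<in>UNIV. (qd a v i z)\<^sup>2)" by (intro sum_nonneg) auto
  with key[OF assms] have "0 \<le> (- 2 * a / ht z) * qd a v None z" by simp
  moreover have "- 2 * a / ht z > 0"
    by (rule divide_pos_pos) (use a assms in \<open>auto simp: half_space_iff\<close>)
  ultimately show ?thesis by (simp only: zero_le_mult_iff) linarith
qed

text \<open>Write q for the vertical component and P for the squared norm of the gradient of log U.
  Then q^2 \<le> P \<le> c q forces q \<le> c, hence P \<le> c^2, and Cauchy-Schwarz gives the bound
  in every direction.\<close>

lemma qd_direction_le:
  assumes z: "z \<in> half_space"
  shows "(\<Sum>i\<in>UNIV. qd a v i z * h $ i) \<le> (- 2 * a / ht z) * norm h"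
proof -
  define c where "c = - 2 * a / ht z"
  define q where "q = qd a v None z"
  have c: "c > 0"
    unfolding c_def by (rule divide_pos_pos) (use a z in \<open>auto simp: half_space_iff\<close>)
  have s: "(\<Sum>i\<in>UNIV. (qd a v i z)\<^sup>2) \<le> c * q" using key[OF z] by (simp add: c_def q_def)
  have "q\<^sup>2 \<le> (\<Sum>i\<in>UNIV. (qd a v i z)\<^sup>2)"
    unfolding q_def by (rule member_le_sum) auto
  with s have "q * q \<le> c * q" by (simp add: power2_eq_square)
  then have "q \<le> c" using c qd_None_nonneg[OF z] by (cases "q = 0") (auto simp: q_def)
  then have "c * q \<le> c * c" using c by simp
  have "(\<Sum>i\<in>UNIV. qd a v i z * h $ i)\<^sup>2 \<le> (\<Sum>i\<in>UNIV. (qd a v i z)\<^sup>2) * (\<Sum>i\<in>UNIV. (h $ i)\<^sup>2)"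
    by (rule Cauchy_Schwarz_ineq_sum)
  also have "(\<Sum>i\<in>UNIV. (h $ i)\<^sup>2) = (norm h)\<^sup>2"
    by (simp add: norm_vec_def L2_set_def sum_nonneg)
  also have "(\<Sum>i\<in>UNIV. (qd a v i z)\<^sup>2) * (norm h)\<^sup>2 \<le> (c * c) * (norm h)\<^sup>2"
    using s \<open>c * q \<le> c * c\<close> by (intro mult_right_mono) auto
  also have "\<dots> = (c * norm h)\<^sup>2" by (simp add: power2_eq_square)
  finally have "\<bar>\<Sum>i\<in>UNIV. qd a v i z * h $ i\<bar> \<le> c * norm h"
    using c by (subst (asm) abs_le_square_iff[symmetric]) simp
  then show ?thesis by (simp add: c_def)
qed

lemma L_mono:
  assumes "z \<in> half_space" "0 \<le> t"
  shows "L z \<le> L (z + t *\<^sub>R e)"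
proof -
  have "(\<lambda>s. L (z + s *\<^sub>R e)) 0 \<le> (\<lambda>s. L (z + s *\<^sub>R e)) t"
  proof (rule DERIV_nonneg_imp_nondecreasing[where f="\<lambda>s. L (z + s *\<^sub>R e)", OF assms(2)])
    fix s assume s: "0 \<le> s" "s \<le> t"
    then have "z + s *\<^sub>R e \<in> half_space" using assms by (simp add: half_space_iff)
    from DERIV_L_line[OF this] qd_None_nonneg[OF this]
    show "\<exists>y. DERIV (\<lambda>s. L (z + s *\<^sub>R e)) s :> y \<and> 0 \<le> y"
      unfolding e_def sum_axis by blast
  qed
  then show ?thesis by simp
qed

lemma U_mono:
  assumes "z \<in> half_space" "0 \<le> t"
  shows "U z \<le> U (z + t *\<^sub>R e)"
  using L_mono[OF assms] U_eq[OF assms(1)] U_eq[of "z + t *\<^sub>R e"] assms by (simp add: half_space_iff)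

text \<open>Join z to e by three segments. Going up to height r = 1 + |z| can only increase L;
  moving horizontally to the axis at height r, over a distance at most r with gradient at most C /
  r, costs at most C; going down the axis from r to 1 costs at most C ln r. Bounding the gradient at
  the original height of z would give nothing uniform near y = 0.\<close>

lemma U_growth: "\<exists>K>0. \<forall>z\<in>half_space. U z \<le> K * (1 + norm z) powr (- 2 * a)"
proof (intro exI conjI ballI)
  show "exp (L e - 2 * a) > 0" by simp
  fix z assume z: "z \<in> (half_space :: (real^('n option)) set)"
  define r where "r = 1 + norm z"
  have r: "r \<ge> 1" "ht z \<le> r" using norm_ht_le[of z] by (auto simp: r_def)
  have c0: "0 \<le> - 2 * a / r" by (rule divide_nonneg_pos) (use a r in auto)
  have "L z \<le> L (z + (r - ht z) *\<^sub>R e)" using z r by (intro L_mono) auto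
  also have "z + (r - ht z) *\<^sub>R e = r *\<^sub>R e + 1 *\<^sub>R hz z"
    by (simp add: e_def hz_def algebra_simps)
  also have "L (r *\<^sub>R e + 1 *\<^sub>R hz z) \<le> L (r *\<^sub>R e) - 2 * a"
  proof -
    have "(\<lambda>t. L (r *\<^sub>R e + t *\<^sub>R hz z) - (- 2 * a) * t) 1 \<le> (\<lambda>t. L (r *\<^sub>R e + t *\<^sub>R hz z) - (- 2 * a) * t) 0"
    proof (rule DERIV_nonpos_imp_nonincreasing[where f="\<lambda>t. L (r *\<^sub>R e + t *\<^sub>R hz z) - (- 2 * a) * t"])
      fix t :: real
      have p: "r *\<^sub>R e + t *\<^sub>R hz z \<in> half_space" "ht (r *\<^sub>R e + t *\<^sub>R hz z) = r"
        using r by (auto simp: half_space_iff)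
      have "(\<Sum>i\<in>UNIV. qd a v i (r *\<^sub>R e + t *\<^sub>R hz z) * hz z $ i) \<le> (- 2 * a / r) * norm (hz z)"
        using qd_direction_le[OF p(1), of "hz z"] p(2) by simp
      also have "\<dots> \<le> (- 2 * a / r) * r"
        by (rule mult_left_mono[OF _ c0]) (use norm_hz_le[of z] in \<open>simp add: r_def\<close>)
      also have "\<dots> = - 2 * a" using r by simp
      finally have "(\<Sum>i\<in>UNIV. qd a v i (r *\<^sub>R e + t *\<^sub>R hz z) * hz z $ i) - (- 2 * a) * 1 \<le> 0" by simp
      moreover have "DERIV (\<lambda>t. L (r *\<^sub>R e + t *\<^sub>R hz z) - (- 2 * a) * t) t :>
          (\<Sum>i\<in>UNIV. qd a v i (r *\<^sub>R e + t *\<^sub>R hz z) * hz z $ i) - (- 2 * a) * 1"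
        by (rule DERIV_diff[OF DERIV_L_line[OF p(1)] DERIV_cmult[OF DERIV_ident]])
      ultimately show "\<exists>y. DERIV (\<lambda>t. L (r *\<^sub>R e + t *\<^sub>R hz z) - (- 2 * a) * t) t :> y \<and> y \<le> 0" by blast
    qed simp
    then show ?thesis by simp
  qed
  also have "L (r *\<^sub>R e) \<le> L e + (- 2 * a) * ln r"
  proof -
    have "(\<lambda>t. L (0 + t *\<^sub>R e) - (- 2 * a) * ln t) r \<le> (\<lambda>t. L (0 + t *\<^sub>R e) - (- 2 * a) * ln t) 1"
    proof (rule DERIV_nonpos_imp_nonincreasing[where f="\<lambda>t. L (0 + t *\<^sub>R e) - (- 2 * a) * ln t", OF r(1)])
      fix t assume t: "1 \<le> t" "t \<le> r"
      have p: "0 + t *\<^sub>R e \<in> half_space" "ht (0 + t *\<^sub>R e) = t"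
        using t by (auto simp: half_space_iff)
      have "(\<Sum>i\<in>UNIV. qd a v i (0 + t *\<^sub>R e) * e $ i) - (- 2 * a) * (1 / t) \<le> 0"
        using qd_direction_le[OF p(1), of e] p(2) by simp
      moreover have "DERIV (\<lambda>t. L (0 + t *\<^sub>R e) - (- 2 * a) * ln t) t :>
          (\<Sum>i\<in>UNIV. qd a v i (0 + t *\<^sub>R e) * e $ i) - (- 2 * a) * (1 / t)"
        using t by (intro DERIV_diff[OF DERIV_L_line[OF p(1)] DERIV_cmult] DERIV_ln_divide) auto
      ultimately show "\<exists>y. DERIV (\<lambda>t. L (0 + t *\<^sub>R e) - (- 2 * a) * ln t) t :> y \<and> y \<le> 0" by blast
    qed
    then show ?thesis by simp
  qed
  finally have "L z \<le> (L e - 2 * a) + (- 2 * a) * ln r" by simp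
  then have "U z \<le> exp ((L e - 2 * a) + (- 2 * a) * ln r)" using U_eq[OF z] by simp
  also have "\<dots> = exp (L e - 2 * a) * r powr (- 2 * a)"
    using r by (subst exp_add) (simp add: powr_def)
  finally show "U z \<le> exp (L e - 2 * a) * (1 + norm z) powr (- 2 * a)" by (simp add: r_def)
qed

section \<open>The lower bound for U\<close>

lemma norm_hz_cbox_le:
  assumes "p \<in> cbox 0 (1 :: real^('n option))"
  shows "norm (hz p) \<le> real CARD('n option)"
proof -
  have "norm (hz p) \<le> norm p" by (rule norm_hz_le)
  also have "\<dots> \<le> (\<Sum>i\<in>UNIV. \<bar>p $ i\<bar>)" by (rule norm_le_l1_cart)
  also have "\<dots> \<le> (\<Sum>i\<in>(UNIV :: 'n option set). 1)"
    using assms by (intro sum_mono) (auto simp: mem_box_cart abs_le_iff intro: order_trans[of _ 0])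
  finally show ?thesis by simp
qed

text \<open>If U < 1 - \<kappa> near z0, monotonicity in y carries this down the whole vertical
  column below that neighbourhood. Thin slabs in the column then see w \<ge> \<kappa>, against the
  convergence to 0 in \<open>zero_trace_slab\<close>.\<close>

lemma U_ge_1:
  assumes z0: "z0 \<in> half_space"
  shows "1 \<le> U z0"
proof (rule ccontr)
  assume "\<not> 1 \<le> U z0"
  define \<kappa> where "\<kappa> = (1 - U z0) / 2"
  have \<kappa>: "\<kappa> > 0" "U z0 < 1 - \<kappa>" using \<open>\<not> 1 \<le> U z0\<close> by (auto simp: \<kappa>_def field_simps)
  have "isCont U z0"
    using continuous_on_U z0 by (simp add: continuous_on_eq_continuous_at open_half_space)
  then have "eventually (\<lambda>z. U z < 1 - \<kappa>) (at z0)"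
    using \<kappa>(2) by (intro order_tendstoD) (auto simp: isCont_def)
  then obtain \<rho> where \<rho>: "\<rho> > 0" "\<And>z. z \<noteq> z0 \<Longrightarrow> dist z z0 < \<rho> \<Longrightarrow> U z < 1 - \<kappa>"
    unfolding eventually_at by auto
  have low: "\<kappa> \<le> 1 - U z" if z: "z \<in> half_space" "ht z \<le> ht z0" "norm (hz (z - z0)) < \<rho>" for z
  proof -
    define p where "p = z + (ht z0 - ht z) *\<^sub>R e"
    have "p - z0 = hz (z - z0)" by (simp add: p_def e_def hz_def algebra_simps)
    then have "U p < 1 - \<kappa>" using \<rho>(2)[of p] \<kappa>(2) z(3) by (cases "p = z0") (auto simp: dist_norm)
    moreover have "U z \<le> U p" unfolding p_def using z by (intro U_mono) auto
    ultimately show ?thesis by simp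
  qed
  \<comment> \<open>With \<open>\<epsilon> k\<close> \<le> y the slabs, which reach up to 3
    \<open>\<epsilon> k\<close>, remain below z0, where \<open>low\<close> applies.\<close>
  define y where "y = min 1 (ht z0 / 3)"
  have y: "0 < y" "y \<le> 1" "3 * y \<le> ht z0" using z0 by (auto simp: y_def half_space_iff)
  define \<epsilon> where "\<epsilon> k = y * inverse (real (Suc k))" for k
  have \<epsilon>: "0 < \<epsilon> k" "\<epsilon> k \<le> y" for k
    using y by (auto simp: \<epsilon>_def field_simps)
  then have \<epsilon>1: "\<epsilon> k \<le> 1" for k using y order_trans by blast
  have "\<epsilon> \<longlonglongrightarrow> y * 0" unfolding \<epsilon>_def by (intro tendsto_intros LIMSEQ_inverse_real_of_nat)
  then have \<epsilon>0: "\<epsilon> \<longlonglongrightarrow> 0" by simp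
  define w where "w z = 1 - U z" for z
  have wH: "w \<in> H10_tilde" using trace by (simp add: w_def[abs_def] U_def)
  define N where "N = real CARD('n option)"
  have N: "N > 0" by (simp add: N_def)
  \<comment> \<open>Horizontal parts of points of the unit cube have norm at most N, so a box of
    side d stays within \<rho> / 2 of z0, as \<open>bump_pos\<close> requires.\<close>
  define d where "d = \<rho> / (2 * N)"
  have d: "d > 0" using \<rho> N by (simp add: d_def)
  note zt = zero_trace_slab[OF wH \<rho>(1), of \<epsilon> z0, OF \<epsilon>(1) \<epsilon>1 \<epsilon>0]
  have box: "norm (hz (z0 - z0) + d *\<^sub>R hz p) \<le> \<rho> / 2" if "p \<in> cbox 0 1" for p
  proof -
    have "d * norm (hz p) \<le> d * N"
      using norm_hz_cbox_le[OF that] d by (intro mult_left_mono) (auto simp: N_def)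
    moreover have "d * N = \<rho> / 2" using N by (simp add: d_def)
    ultimately show ?thesis using d by (simp add: hz_lin)
  qed
  have wc: "continuous_on half_space w" unfolding w_def by (intro continuous_intros continuous_on_U)
  have "d ^ CARD('n) * (\<rho> ^ 4 / 4) * \<kappa> \<le> (LINT z:half_ball (norm z0 + \<rho> + 4)|lebesgue. w z * slab z0 \<rho> (\<epsilon> k) z) / \<epsilon> k" for k
  proof -
    have ge: "w z * slab z0 \<rho> (\<epsilon> k) z \<ge> 0" if z: "z \<in> half_ball (norm z0 + \<rho> + 4)" for z
    proof (cases "slab z0 \<rho> (\<epsilon> k) z = 0")
      case False
      then have "bump z0 \<rho> z \<noteq> 0" and "3 - ht z / \<epsilon> k > 0" by (auto simp: slab_def max_def split: if_splits)
      then have "norm (hz (z - z0)) < \<rho>" "ht z < 3 * \<epsilon> k"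
        using bump_eq_0[of \<rho> z z0] \<rho>(1) \<epsilon>(1)[of k] by (force simp: field_simps)+
      then have "\<kappa> \<le> w z"
        unfolding w_def using z half_ball_subset \<epsilon>(2)[of k] y by (intro low) auto
      then show ?thesis
        using \<kappa> by (intro mult_nonneg_nonneg) (auto simp: slab_def bump_nonneg)
    qed simp
    have "\<epsilon> k * d ^ CARD('n) * (\<rho> ^ 4 / 4) *
      integral (cbox 0 1) (\<lambda>p. w (hz z0 + d *\<^sub>R hz p + (\<epsilon> k + \<epsilon> k * ht p) *\<^sub>R axis None 1))
      \<le> (LINT z:half_ball (norm z0 + \<rho> + 4)|lebesgue. w z * slab z0 \<rho> (\<epsilon> k) z)"
      by (rule slab_box_le[OF \<rho>(1) \<epsilon>(1) \<epsilon>1 d box wc zt(1) ge])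
    moreover have "\<kappa> \<le> integral (cbox 0 1) (\<lambda>p. w (hz z0 + d *\<^sub>R hz p + (\<epsilon> k + \<epsilon> k * ht p) *\<^sub>R axis None 1))"
    proof -
      have inh: "hz z0 + d *\<^sub>R hz p + (\<epsilon> k + \<epsilon> k * ht p) *\<^sub>R axis None 1 \<in> half_space"
        "ht (hz z0 + d *\<^sub>R hz p + (\<epsilon> k + \<epsilon> k * ht p) *\<^sub>R axis None 1) \<le> 2 * \<epsilon> k" if "p \<in> cbox 0 1" for p :: "real^('n option)"
      proof -
        have "0 \<le> ht p" "ht p \<le> 1" using that by (auto simp: mem_box_cart ht_def)
        moreover from this have "\<epsilon> k * ht p \<le> \<epsilon> k * 1" using \<epsilon>(1)[of k] by (intro mult_left_mono) auto
        ultimately show "hz z0 + d *\<^sub>R hz p + (\<epsilon> k + \<epsilon> k * ht p) *\<^sub>R axis None 1 \<in> half_space"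
          "ht (hz z0 + d *\<^sub>R hz p + (\<epsilon> k + \<epsilon> k * ht p) *\<^sub>R axis None 1) \<le> 2 * \<epsilon> k"
          using \<epsilon>(1)[of k] by (auto simp: half_space_iff add_pos_nonneg)
      qed
      have "integral (cbox 0 (1 :: real^('n option))) (\<lambda>p. \<kappa>) \<le> integral (cbox 0 1) (\<lambda>p. w (hz z0 + d *\<^sub>R hz p + (\<epsilon> k + \<epsilon> k * ht p) *\<^sub>R axis None 1))"
      proof (rule integral_le)
        show "(\<lambda>p. w (hz z0 + d *\<^sub>R hz p + (\<epsilon> k + \<epsilon> k * ht p) *\<^sub>R axis None 1)) integrable_on cbox 0 1"
          by (intro integrable_continuous continuous_on_compose2[OF wc] continuous_intros) (use inh(1) in blast)
        fix p :: "real^('n option)" assume p: "p \<in> cbox 0 1"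
        have "hz (hz x) = hz x" for x :: "real^('n option)" by (simp add: vec_eq_iff hz_nth)
        then have "hz (hz z0 + d *\<^sub>R hz p + (\<epsilon> k + \<epsilon> k * ht p) *\<^sub>R axis None 1 - z0) = hz (z0 - z0) + d *\<^sub>R hz p"
          by (simp add: hz_lin)
        then have "norm (hz (hz z0 + d *\<^sub>R hz p + (\<epsilon> k + \<epsilon> k * ht p) *\<^sub>R axis None 1 - z0)) \<le> \<rho> / 2"
          using box[OF p] by simp
        then show "\<kappa> \<le> w (hz z0 + d *\<^sub>R hz p + (\<epsilon> k + \<epsilon> k * ht p) *\<^sub>R axis None 1)"
          unfolding w_def using inh(2)[OF p] box[OF p] \<rho>(1) \<epsilon>[of k] y
          by (intro low[OF inh(1)[OF p]]) linarith+
      qed (rule integrable_const)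
      then show ?thesis by (simp add: content_unit_cbox)
    qed
    moreover have "\<epsilon> k * d ^ CARD('n) * (\<rho> ^ 4 / 4) \<ge> 0" using \<epsilon>(1)[of k] d by (intro mult_nonneg_nonneg) auto
    ultimately have "\<epsilon> k * d ^ CARD('n) * (\<rho> ^ 4 / 4) * \<kappa> \<le> (LINT z:half_ball (norm z0 + \<rho> + 4)|lebesgue. w z * slab z0 \<rho> (\<epsilon> k) z)"
      by (meson mult_left_mono order_trans)
    then show ?thesis using \<epsilon>(1)[of k] by (simp add: pos_le_divide_eq mult_ac)
  qed
  then have "d ^ CARD('n) * (\<rho> ^ 4 / 4) * \<kappa> \<le> 0"
    by (intro LIMSEQ_le_const[OF zt(2)]) auto
  moreover have "d ^ CARD('n) * (\<rho> ^ 4 / 4) * \<kappa> > 0" using d \<rho> \<kappa> by simp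
  ultimately show False by simp
qed

end

section \<open>Horizontal averages, a barrier and the maximum principle\<close>

lemma second_derivative_test_max:
  fixes f f' :: "real \<Rightarrow> real"
  assumes d: "d > 0" and f: "\<And>t. \<bar>t\<bar> < d \<Longrightarrow> DERIV f t :> f' t"
    and f': "DERIV f' 0 :> l" and max: "\<And>t. \<bar>t\<bar> < d \<Longrightarrow> f t \<le> f 0"
  shows "f' 0 = 0" "l \<le> 0"
proof -
  show z: "f' 0 = 0"
    by (rule DERIV_local_max[OF f d]) (use d max in auto)
  show "l \<le> 0"
  proof (rule ccontr)
    assume "\<not> l \<le> 0"
    then obtain s where s: "s > 0" "\<And>h. 0 < h \<Longrightarrow> h < s \<Longrightarrow> f' 0 < f' (0 + h)"
      using DERIV_pos_inc_right[OF f'] by auto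
    define t where "t = min s d / 2"
    have t: "0 < t" "t < s" "t < d" using s d by (auto simp: t_def)
    obtain x where x: "0 < x" "x < t" "f t - f 0 = (t - 0) * f' x"
      using MVT2[OF t(1), of f f'] f t by (auto simp: abs_less_iff)
    have "f' x > 0" using s(2)[of x] x t z by auto
    then have "(t - 0) * f' x > 0" using t by simp
    then show False using x(3) max[of t] t by simp
  qed
qed

text \<open>The vertical component of the integration variable is a dummy: only horizontal translations are averaged.\<close>

definition av :: "(real^('n::finite option) \<Rightarrow> real) \<Rightarrow> real^('n option) \<Rightarrow> real" where
  "av f z = integral (cbox 0 1) (\<lambda>p. f (z + hz p))"

lemma half_space_add_hz: "z + hz p \<in> half_space \<longleftrightarrow> z \<in> half_space"
  by (simp add: half_space_def)

lemma av_continuous: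
  fixes f :: "real^('n::finite option) \<Rightarrow> real"
  assumes "continuous_on half_space f"
  shows "continuous_on half_space (av f)"
  unfolding av_def
  by (rule integral_continuous_on_param, unfold case_prod_unfold)
    (auto intro!: continuous_on_compose2[OF assms] continuous_intros simp: half_space_add_hz)

lemma av_integrable:
  fixes f :: "real^('n::finite option) \<Rightarrow> real"
  assumes "continuous_on half_space f" "z \<in> half_space"
  shows "(\<lambda>p. f (z + hz p)) integrable_on cbox a b"
  by (intro integrable_continuous continuous_on_compose2[OF assms(1)] continuous_intros)
    (use assms(2) in \<open>auto simp: half_space_add_hz\<close>)

text \<open>Derivatives of averages are stated along coordinate lines. This is all that the maximum
  principle consumes, and it avoids proving total differentiability of the averages.\<close>

lemma av_DERIV:
  fixes f :: "real^('n::finite option) \<Rightarrow> real"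
  assumes f: "C1_on half_space f" and z: "z \<in> half_space"
  shows "DERIV (\<lambda>t. av f (z + t *\<^sub>R axis i 1)) 0 :> av (pd i f) z"
proof -
  define e where "e = (axis i 1 :: real^('n option))"
  have fd: "f differentiable at p" if "p \<in> half_space" for p
    by (rule C1_onD[OF f open_half_space that])
  have fc: "continuous_on half_space f" "continuous_on half_space (pd i f)"
    using f by (auto simp: C1_on_def differentiable_imp_continuous_on)
  \<comment> \<open>A displacement of size below \<open>ht z\<close> along any axis cannot leave the
    half-space.\<close>
  define S where "S = {- ht z<..<ht z}"
  have S: "z + t *\<^sub>R e \<in> half_space" if "t \<in> S" for t
    using that by (auto simp: S_def half_space_def e_def)
  have z0: "0 \<in> S" using z by (simp add: S_def half_space_def)
  have "((\<lambda>t. integral (cbox 0 1) (\<lambda>p. f (z + t *\<^sub>R e + hz p))) has_field_derivative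
      integral (cbox 0 1) (\<lambda>p. pd i f (z + 0 *\<^sub>R e + hz p))) (at 0 within S)"
  proof (rule leibniz_rule_field_derivative[where f="\<lambda>t p. f (z + t *\<^sub>R e + hz p)" and fx="\<lambda>t p. pd i f (z + t *\<^sub>R e + hz p)"])
    show "((\<lambda>t. f (z + t *\<^sub>R e + hz p)) has_field_derivative pd i f (z + t *\<^sub>R e + hz p)) (at t within S)"
      if "t \<in> S" for t p
    proof -
      have "(z + hz p) + t *\<^sub>R e \<in> half_space"
        using S[OF that] by (simp add: half_space_def)
      from has_pd_axis[OF fd[OF this[unfolded e_def]], folded e_def]
      have "DERIV (\<lambda>t. f (z + hz p + t *\<^sub>R e)) t :> pd i f (z + hz p + t *\<^sub>R e)" .
      moreover have "z + hz p + t *\<^sub>R e = z + t *\<^sub>R e + hz p" for t by simp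
      ultimately show ?thesis by (simp only: has_field_derivative_at_within)
    qed
    show "(\<lambda>p. f (z + t *\<^sub>R e + hz p)) integrable_on cbox 0 1" if "t \<in> S" for t
      by (rule av_integrable[OF fc(1) S[OF that]])
    show "continuous_on (S \<times> cbox 0 1) (\<lambda>(t, p). pd i f (z + t *\<^sub>R e + hz p))"
      unfolding case_prod_unfold
      by (intro continuous_on_compose2[OF fc(2)] continuous_intros) (auto simp: half_space_add_hz S)
    show "convex S" unfolding S_def by (rule convex_real_interval)
  qed (rule z0)
  moreover have "at 0 within S = at 0"
    by (rule at_within_open[OF z0]) (simp add: S_def)
  ultimately show ?thesis by (simp add: av_def e_def)
qed

lemma DERIV_shift_axis:
  assumes "\<And>z. z \<in> half_space \<Longrightarrow> DERIV (\<lambda>t. F (z + t *\<^sub>R axis i 1)) 0 :> F' z"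
    and "z + t *\<^sub>R axis i 1 \<in> half_space"
  shows "DERIV (\<lambda>t. F (z + t *\<^sub>R axis i 1)) t :> F' (z + t *\<^sub>R axis i 1)"
proof -
  have "DERIV (\<lambda>s. F ((z + t *\<^sub>R axis i 1) + s *\<^sub>R axis i 1)) 0 :> F' (z + t *\<^sub>R axis i 1)"
    by (rule assms(1)[OF assms(2)])
  then have "DERIV (\<lambda>s. F (z + (s + t) *\<^sub>R axis i 1)) 0 :> F' (z + t *\<^sub>R axis i 1)"
    by (simp add: scaleR_add_left add_ac)
  then show ?thesis
    using DERIV_shift[of "\<lambda>t. F (z + t *\<^sub>R axis i 1)" "F' (z + t *\<^sub>R axis i 1)" 0 t] by simp
qed

lemma half_space_max_derivatives:
  fixes F :: "real^('n::finite option) \<Rightarrow> real"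
  assumes F: "\<And>z i. z \<in> half_space \<Longrightarrow> DERIV (\<lambda>t. F (z + t *\<^sub>R axis i 1)) 0 :> F1 i z"
    and F1: "\<And>z i. z \<in> half_space \<Longrightarrow> DERIV (\<lambda>t. F1 i (z + t *\<^sub>R axis i 1)) 0 :> F2 i z"
    and z0: "z0 \<in> half_space" and max: "\<And>z. z \<in> half_space \<Longrightarrow> F z \<le> F z0"
  shows "F1 i z0 = 0" "F2 i z0 \<le> 0"
proof -
  have S: "z0 + t *\<^sub>R axis i 1 \<in> half_space" if "\<bar>t\<bar> < ht z0" for t
    using that by (auto simp: half_space_def)
  have pos: "ht z0 > 0" using z0 by (simp add: half_space_def)
  have D: "DERIV (\<lambda>t. F (z0 + t *\<^sub>R axis i 1)) t :> F1 i (z0 + t *\<^sub>R axis i 1)" if "\<bar>t\<bar> < ht z0" for t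
    by (rule DERIV_shift_axis[OF F S[OF that]])
  have M: "F (z0 + t *\<^sub>R axis i 1) \<le> F (z0 + 0 *\<^sub>R axis i 1)" if "\<bar>t\<bar> < ht z0" for t
    using max[OF S[OF that]] by simp
  note T = second_derivative_test_max[of "ht z0" "\<lambda>t. F (z0 + t *\<^sub>R axis i 1)" "\<lambda>t. F1 i (z0 + t *\<^sub>R axis i 1)",
      OF pos D F1[OF z0] M]
  show "F1 i z0 = 0" "F2 i z0 \<le> 0" using T by simp_all
qed

text \<open>
  Below \<open>b = (C + 1/4) / 2\<close> and \<open>m = (C - 3/4) / 2\<close>, so that the function $|z|^{2b} + A\, |z|^{2m} y$
  is homogeneous of degree $C + 1/4$. For large \<open>A\<close> it is a supersolution of
  $\Delta u = (n - 1 + C)\, y^{-1} \partial_y u$: the first term alone has the wrong sign,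
  but the second one compensates for it, uniformly up to the boundary.
\<close>

definition bar :: "real \<Rightarrow> real \<Rightarrow> real \<Rightarrow> real^('n::finite option) \<Rightarrow> real" where
  "bar b m A z = (z \<bullet> z) powr b + A * ((z \<bullet> z) powr m * ht z)"

definition bar1 :: "real \<Rightarrow> real \<Rightarrow> real \<Rightarrow> 'n option \<Rightarrow> real^('n::finite option) \<Rightarrow> real" where
  "bar1 b m A i z = b * (z \<bullet> z) powr (b - 1) * (2 * z $ i)
     + A * (m * (z \<bullet> z) powr (m - 1) * (2 * z $ i) * ht z
          + (z \<bullet> z) powr m * (if i = None then 1 else 0))"

definition bar2 :: "real \<Rightarrow> real \<Rightarrow> real \<Rightarrow> 'n option \<Rightarrow> real^('n::finite option) \<Rightarrow> real" where
  "bar2 b m A i z = b * ((b - 1) * (z \<bullet> z) powr (b - 2) * (2 * z $ i)\<^sup>2 + (z \<bullet> z) powr (b - 1) * 2)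
     + A * (m * ((m - 1) * (z \<bullet> z) powr (m - 2) * (2 * z $ i)\<^sup>2 + (z \<bullet> z) powr (m - 1) * 2) * ht z
          + 2 * (m * (z \<bullet> z) powr (m - 1) * (2 * z $ i)) * (if i = None then 1 else 0))"

lemma half_space_inner_pos: "z \<in> half_space \<Longrightarrow> z \<bullet> z > 0"
  by (auto simp: half_space_def)

lemma DERIV_powr_axis:
  assumes "z \<bullet> z > 0"
  shows "DERIV (\<lambda>t. ((z + t *\<^sub>R axis i 1) \<bullet> (z + t *\<^sub>R axis i 1)) powr c) 0 :> c * (z \<bullet> z) powr (c - 1) * (2 * z $ i)"
proof -
  have "(z + t *\<^sub>R axis i 1) \<bullet> (z + t *\<^sub>R axis i 1) = z \<bullet> z + 2 * z $ i * t + t\<^sup>2" for t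
    by (simp add: inner_add_left inner_add_right inner_axis inner_axis' power2_eq_square algebra_simps)
  then show ?thesis
    using assms by (auto intro!: derivative_eq_intros simp: algebra_simps powr_diff)
qed

lemma DERIV_ht_axis: "DERIV (\<lambda>t. ht (z + t *\<^sub>R axis i 1)) t :> (if i = None then 1 else 0)"
  by (auto intro!: derivative_eq_intros)

lemma DERIV_nth_axis: "DERIV (\<lambda>t. (z + t *\<^sub>R axis i 1) $ i) t :> 1"
  by (auto intro!: derivative_eq_intros simp: axis_def)

lemma DERIV_bar:
  assumes z: "z \<in> half_space"
  shows "DERIV (\<lambda>t. bar b m A (z + t *\<^sub>R axis i 1)) 0 :> bar1 b m A i z"
proof -
  note D = DERIV_powr_axis[OF half_space_inner_pos[OF z], of i]
  show ?thesis
    unfolding bar_def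
    by (rule DERIV_cong, (rule DERIV_add DERIV_mult DERIV_const DERIV_ht_axis D)+)
      (simp add: bar1_def mult_ac)
qed

lemma DERIV_bar1:
  assumes z: "z \<in> half_space"
  shows "DERIV (\<lambda>t. bar1 b m A i (z + t *\<^sub>R axis i 1)) 0 :> bar2 b m A i z"
proof -
  note D = DERIV_powr_axis[OF half_space_inner_pos[OF z], of i]
  show ?thesis
    unfolding bar1_def
    by (rule DERIV_cong, (rule DERIV_add DERIV_mult DERIV_const DERIV_ht_axis DERIV_nth_axis D)+)
      (simp add: bar2_def algebra_simps power2_eq_square)
qed

text \<open>After multiplication by y, and up to the common factor \<open>X\<close>, the first
  summand of the barrier contributes b/2 * y |z|, of the wrong sign. The second contributes A times
  5/4 (C - 3/4) y^2 - (n - 1 + C) |z|^2, whose last term comes from the y-derivative of the factor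
  y. As y \<le> |z|, this is at most - A * min C (7/16) * |z|^2, and the condition on A says A * min
  C (7/16) \<ge> 2 b > b / 2.\<close>

lemma bar_supersolution:
  fixes z :: "real^('n::finite option)"
  assumes C: "0 < C" "C \<le> 2" and z: "z \<in> half_space"
    and A: "A * min C (7/16) \<ge> C + 1/4"
    and b: "b = (C + 1/4) / 2" and m: "m = (C - 3/4) / 2"
  shows "(\<Sum>i\<in>UNIV. bar2 b m A i z) < (real CARD('n) - 1 + C) * bar1 b m A None z / ht z"
proof -
  define y where "y = ht z"
  define Q where "Q = z \<bullet> z"
  define n where "n = real CARD('n)"
  define X where "X = Q powr (m - 1)"
  define r where "r = sqrt Q"
  have y: "y > 0" using z by (simp add: y_def half_space_def)
  have Q: "Q > 0" using half_space_inner_pos[OF z] by (simp add: Q_def)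
  have r: "r > 0" "r * r = Q" using Q by (auto simp: r_def)
  have n: "n \<ge> 1"
    unfolding n_def using zero_less_card_finite[where 'a='n] by linarith
  have rn: "r = norm z" by (simp add: r_def Q_def norm_eq_sqrt_inner)
  have yr: "y \<le> r" using norm_ht_le[of z] by (simp add: rn y_def)
  have A0: "A > 0"
  proof (rule ccontr)
    assume "\<not> A > 0"
    then have "A * min C (7/16) \<le> 0" using C by (simp add: mult_nonpos_nonneg)
    then show False using A C by simp
  qed
  have Qm: "Q powr m = Q * X"
    using Q powr_add[of Q 1 "m - 1"] by (simp add: X_def)
  have Qm2: "Q * Q powr (m - 2) = X"
    using Q powr_add[of Q 1 "m - 2"] by (simp add: X_def)
  have Qb: "Q powr (b - 1) = r * X"
  proof -
    have "Q powr (b - 1) = Q powr (1/2) * Q powr (m - 1)"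
      by (subst powr_add[symmetric]) (simp add: b m field_simps)
    then show ?thesis using Q by (simp add: X_def r_def powr_half_sqrt)
  qed
  have Qb2: "Q * Q powr (b - 2) = r * X"
    using Q powr_add[of Q 1 "b - 2"] Qb by simp
  have sq: "(\<Sum>i\<in>UNIV. (z $ i)\<^sup>2) = Q"
    by (simp add: Q_def inner_vec_def power2_eq_square)
  have N: "real CARD('n option) = n + 1" by (simp add: n_def)
  have split: "bar2 b m A i z = (4 * b * (b - 1) * Q powr (b - 2) + 4 * A * m * (m - 1) * Q powr (m - 2) * y) * (z $ i)\<^sup>2
     + (2 * b * Q powr (b - 1) + 2 * A * m * Q powr (m - 1) * y)
     + (if i = None then 4 * A * m * Q powr (m - 1) * y else 0)" for i
    unfolding bar2_def Q_def[symmetric] y_def[symmetric]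
    by (auto simp: algebra_simps power2_eq_square y_def ht_def)
  have "(\<Sum>i\<in>UNIV. bar2 b m A i z) = (4 * b * (b - 1) * Q powr (b - 2) + 4 * A * m * (m - 1) * Q powr (m - 2) * y) * Q
     + (n + 1) * (2 * b * Q powr (b - 1) + 2 * A * m * Q powr (m - 1) * y) + 4 * A * m * Q powr (m - 1) * y"
    unfolding split sum.distrib sum_distrib_left[symmetric] sq by (simp add: n_def algebra_simps)
  also have "\<dots> = 4 * b * (b - 1) * (Q * Q powr (b - 2)) + 4 * A * m * (m - 1) * (Q * Q powr (m - 2)) * y
     + (n + 1) * (2 * b * Q powr (b - 1) + 2 * A * m * Q powr (m - 1) * y) + 4 * A * m * Q powr (m - 1) * y"
    by (simp add: algebra_simps)
  also have "\<dots> = r * X * (4 * b * (b - 1) + 2 * b * (n + 1)) + A * m * X * y * (4 * (m - 1) + 2 * (n + 1) + 4)"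
    unfolding Qb Qb2 Qm2 X_def[symmetric] by (simp add: algebra_simps)
  finally have S2: "(\<Sum>i\<in>UNIV. bar2 b m A i z) = r * X * (4 * b * (b - 1) + 2 * b * (n + 1)) + A * m * X * y * (4 * (m - 1) + 2 * (n + 1) + 4)" .
  have "bar1 b m A None z = b * Q powr (b - 1) * (2 * y) + A * (m * Q powr (m - 1) * (2 * y) * y + Q powr m)"
    unfolding bar1_def Q_def[symmetric] by (simp add: y_def ht_def)
  also have "\<dots> = 2 * b * r * X * y + A * (2 * m * X * y * y + Q * X)"
    unfolding Qb Qm X_def[symmetric] by simp
  finally have S1: "bar1 b m A None z = 2 * b * r * X * y + A * (2 * m * X * y * y + Q * X)" .
  define \<theta> where "\<theta> = min C (7/16)"
  have \<theta>: "\<theta> > 0" using C by (simp add: \<theta>_def)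
  have yQ: "y * y \<le> Q" "y * r \<le> Q"
    using mult_mono[OF yr yr] mult_right_mono[OF yr, of r] r y by auto
  \<comment> \<open>For C \<ge> 3/4, replacing y^2 by |z|^2 gives the coefficient C/4 - 15/16 - (n -
    1), at most -7/16 because C \<le> 2 and n \<ge> 1. For smaller C the first term is nonpositive
    and n - 1 + C \<ge> C remains.\<close>
  have E: "5/4 * (C - 3/4) * (y * y) - (n - 1 + C) * Q \<le> - \<theta> * Q"
  proof (cases "C \<ge> 3/4")
    case True
    have "5/4 * (C - 3/4) * (y * y) \<le> 5/4 * (C - 3/4) * Q" using True yQ by (intro mult_left_mono) auto
    moreover have "(5/4 * (C - 3/4) - (n - 1 + C)) * Q \<le> - (7/16) * Q"
    proof (rule mult_right_mono)
      show "5/4 * (C - 3/4) - (n - 1 + C) \<le> - (7/16)" using n C by (simp add: field_simps)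
    qed (use Q in simp)
    moreover have "\<theta> * Q \<le> 7/16 * Q" using Q by (intro mult_right_mono) (auto simp: \<theta>_def)
    ultimately show ?thesis by (simp add: algebra_simps)
  next
    case False
    have "5/4 * (C - 3/4) * (y * y) \<le> 0" by (rule mult_nonpos_nonneg) (use False in auto)
    moreover have "\<theta> * Q \<le> (n - 1 + C) * Q" using Q n by (intro mult_right_mono) (auto simp: \<theta>_def)
    ultimately show ?thesis by simp
  qed
  \<comment> \<open>The dimension drops out of these coefficients: they are 2 b (2 b - C) = b / 2,
    as 2 b - C = 1/4, and m (4 m + 4 - 2 C) = 5/4 (C - 3/4), as 4 m + 4 - 2 C = 5/2.\<close>
  have "y * (\<Sum>i\<in>UNIV. bar2 b m A i z) - (n - 1 + C) * bar1 b m A None z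
    = X * (b / 2 * (y * r) + A * (5/4 * (C - 3/4) * (y * y) - (n - 1 + C) * Q))"
    unfolding S1 S2 unfolding b m by (simp add: field_simps)
  also have "\<dots> \<le> X * (b / 2 * Q + A * (- \<theta> * Q))"
    using C A0 yQ E Q by (intro mult_left_mono add_mono) (auto simp: X_def b)
  also have "\<dots> = X * Q * (b / 2 - A * \<theta>)" by (simp add: algebra_simps)
  also have "\<dots> < 0"
    using A C Q by (intro mult_pos_neg mult_pos_pos) (auto simp: X_def b \<theta>_def)
  finally have "y * (\<Sum>i\<in>UNIV. bar2 b m A i z) < (n - 1 + C) * bar1 b m A None z" by simp
  then show ?thesis using y by (simp add: y_def n_def pos_less_divide_eq mult.commute)
qed

section \<open>The upper bound for the averages, and rigidity\<close>

context flat_solution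
begin

text \<open>Horizontal translation preserves the height, so the weight y^(-a) leaves the average.
  All derivatives of \<open>av U\<close> are thereby reduced to averages of derivatives of
  v.\<close>

lemma av_U_eq: "av U z = av v z * ht z powr (- a)"
  by (simp add: av_def U_def powr_minus divide_inverse)

lemma av_continuous_U: "continuous_on half_space (av U)"
  by (rule av_continuous[OF continuous_on_U])

lemma av_U_growth: "\<exists>K>0. \<forall>z\<in>half_space. av U z \<le> K * (1 + norm z) powr (- 2 * a)"
proof -
  define N where "N = real CARD('n option)"
  obtain K where K: "K > 0" "\<And>z. z \<in> half_space \<Longrightarrow> U z \<le> K * (1 + norm z) powr (- 2 * a)"
    using U_growth by blast
  have N: "N > 0" by (simp add: N_def)
  show ?thesis
  proof (intro exI conjI ballI)
    show "K * (1 + N) powr (- 2 * a) > 0" using K N by simp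
    fix z assume z: "z \<in> (half_space :: (real^('n option)) set)"
    have "U (z + hz p) \<le> K * ((1 + N) * (1 + norm z)) powr (- 2 * a)" if "p \<in> cbox 0 1" for p
    proof -
      have "norm (z + hz p) \<le> norm z + N"
        using norm_hz_cbox_le[OF that] norm_triangle_ineq[of z "hz p"] by (simp add: N_def)
      also have "\<dots> \<le> (1 + N) * (1 + norm z) - 1" using N by (simp add: algebra_simps)
      finally have "(1 + norm (z + hz p)) powr (- 2 * a) \<le> ((1 + N) * (1 + norm z)) powr (- 2 * a)"
        using a by (intro powr_mono2) auto
      then have "K * (1 + norm (z + hz p)) powr (- 2 * a) \<le> K * ((1 + N) * (1 + norm z)) powr (- 2 * a)"
        using K by (intro mult_left_mono) auto
      then show ?thesis using K(2)[of "z + hz p"] z by (simp add: half_space_add_hz)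
    qed
    then have "av U z \<le> integral (cbox 0 (1 :: real^('n option))) (\<lambda>p. K * ((1 + N) * (1 + norm z)) powr (- 2 * a))"
      unfolding av_def
      by (intro integral_le av_integrable[OF continuous_on_U z] integrable_const)
    then show "av U z \<le> K * (1 + N) powr (- 2 * a) * (1 + norm z) powr (- 2 * a)"
      using N by (simp add: content_unit_cbox powr_mult)
  qed
qed

text \<open>Since U - 1 \<ge> 0, a slab integral dominates the integral of U - 1 over any box inside
  the slab. A point z below height \<open>\<epsilon> k\<close> has its averaging cube beneath such a
  box, and monotonicity in y compares the two. One slab contains the boxes for all z of norm at most
  R, which makes the estimate uniform.\<close>

lemma av_U_boundary:
  assumes R: "R > 0" and \<eta>: "\<eta> > 0"
  shows "\<exists>y>0. \<forall>z\<in>half_space. norm z \<le> R \<longrightarrow> ht z \<le> y \<longrightarrow> av U z \<le> 1 + \<eta>"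
proof -
  define N where "N = real CARD('n option)"
  \<comment> \<open>Half the radius is R + N: norm at most R for the point plus at most N for the
    shift within the unit cube.\<close>
  define \<rho> where "\<rho> = 2 * (R + N)"
  have \<rho>: "\<rho> > 0" using R by (simp add: \<rho>_def N_def add_pos_pos)
  define \<epsilon> where "\<epsilon> k = inverse (real (Suc k))" for k
  have \<epsilon>: "0 < \<epsilon> k" "\<epsilon> k \<le> 1" for k by (auto simp: \<epsilon>_def field_simps)
  have \<epsilon>0: "\<epsilon> \<longlonglongrightarrow> 0" unfolding \<epsilon>_def by (rule LIMSEQ_inverse_real_of_nat)
  define w where "w z = 1 - U z" for z
  define g where "g z = U z - 1" for z
  have wH: "w \<in> H10_tilde" using trace by (simp add: w_def[abs_def] U_def)
  have zt: "set_integrable lebesgue (half_ball (norm (0 :: real^('n option)) + \<rho> + 4)) (\<lambda>z. w z * slab 0 \<rho> (\<epsilon> k) z)"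
      "(\<lambda>k. (LINT z:half_ball (norm (0 :: real^('n option)) + \<rho> + 4)|lebesgue. w z * slab 0 \<rho> (\<epsilon> k) z) / \<epsilon> k) \<longlonglongrightarrow> 0" for k
    by (rule zero_trace_slab[OF wH \<rho> \<epsilon> \<epsilon>0])+
  define J where "J k = (LINT z:half_ball (norm (0 :: real^('n option)) + \<rho> + 4)|lebesgue. w z * slab 0 \<rho> (\<epsilon> k) z)" for k
  have gw: "(\<lambda>z. g z * slab 0 \<rho> (\<epsilon> k) z) = (\<lambda>z. (- 1) * (w z * slab 0 \<rho> (\<epsilon> k) z))" for k
    by (auto simp: g_def w_def algebra_simps)
  have gi: "set_integrable lebesgue (half_ball (norm (0 :: real^('n option)) + \<rho> + 4)) (\<lambda>z. g z * slab 0 \<rho> (\<epsilon> k) z)" for k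
    unfolding gw by (rule set_integrable_mult_right) (rule zt)
  have gJ: "(LINT z:half_ball (norm (0 :: real^('n option)) + \<rho> + 4)|lebesgue. g z * slab 0 \<rho> (\<epsilon> k) z) = - J k" for k
    unfolding gw set_integral_mult_right J_def by simp
  have gc: "continuous_on half_space g" unfolding g_def by (intro continuous_intros continuous_on_U)
  have "\<rho> ^ 4 / 4 * \<eta> > 0" using \<rho> \<eta> by simp
  then have "eventually (\<lambda>k. - (\<rho> ^ 4 / 4 * \<eta>) < J k / \<epsilon> k) sequentially"
    using zt(2) unfolding J_def by (intro order_tendstoD) auto
  then obtain k where k: "- (\<rho> ^ 4 / 4 * \<eta>) < J k / \<epsilon> k"
    by (auto simp: eventually_sequentially)
  show ?thesis
  proof (intro exI conjI ballI impI)
    show "\<epsilon> k > 0" by (rule \<epsilon>)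
    fix z assume z: "z \<in> (half_space :: (real^('n option)) set)" "norm z \<le> R" "ht z \<le> \<epsilon> k"
    define T where "T p = hz z + 1 *\<^sub>R hz p + (\<epsilon> k + \<epsilon> k * ht p) *\<^sub>R axis None 1" for p
    have ht_T: "ht (T p) = \<epsilon> k + \<epsilon> k * ht p" for p by (simp add: T_def)
    have p0: "0 \<le> ht p" if "p \<in> cbox 0 1" for p :: "real^('n option)"
      using that by (auto simp: mem_box_cart ht_def)
    have TH: "T p \<in> half_space" if "p \<in> cbox 0 1" for p
      using p0[OF that] \<epsilon>(1)[of k] by (simp add: half_space_iff ht_T add_pos_nonneg)
    have box: "norm (hz (z - 0) + 1 *\<^sub>R hz p) \<le> \<rho> / 2" if "p \<in> cbox 0 1" for p
      using norm_triangle_ineq[of "hz z" "hz p"] norm_hz_le[of z] norm_hz_cbox_le[OF that] z(2)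
      by (simp add: \<rho>_def N_def)
    have g0: "0 \<le> g x * slab 0 \<rho> (\<epsilon> k) x" if "x \<in> half_ball (norm (0 :: real^('n option)) + \<rho> + 4)" for x
      using U_ge_1[of x] that half_ball_subset
      by (intro mult_nonneg_nonneg) (auto simp: g_def slab_def bump_nonneg)
    have "\<epsilon> k * 1 ^ CARD('n) * (\<rho> ^ 4 / 4) * integral (cbox 0 1) (\<lambda>p. g (T p)) \<le> - J k"
      unfolding T_def gJ[symmetric]
      by (rule slab_box_le[OF \<rho> \<epsilon> zero_less_one box gc gi g0])
    also have "- J k \<le> \<epsilon> k * (\<rho> ^ 4 / 4) * \<eta>"
      using k \<epsilon>(1)[of k] by (simp add: pos_less_divide_eq algebra_simps)
    finally have "(\<epsilon> k * (\<rho> ^ 4 / 4)) * integral (cbox 0 1) (\<lambda>p. g (T p)) \<le> (\<epsilon> k * (\<rho> ^ 4 / 4)) * \<eta>"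
      by simp
    moreover have "\<epsilon> k * (\<rho> ^ 4 / 4) > 0" using \<epsilon>(1)[of k] \<rho> by simp
    ultimately have "integral (cbox 0 1) (\<lambda>p. g (T p)) \<le> \<eta>"
      by (simp only: mult_le_cancel_left_pos)
    moreover have "integral (cbox 0 1) (\<lambda>p. U (z + hz p) - 1) \<le> integral (cbox 0 1) (\<lambda>p. g (T p))"
    proof (rule integral_le)
      show "(\<lambda>p. U (z + hz p) - 1) integrable_on cbox 0 1"
        by (intro integrable_diff av_integrable[OF continuous_on_U z(1)] integrable_const)
      show "(\<lambda>p. g (T p)) integrable_on cbox 0 1"
        unfolding T_def
        by (intro integrable_continuous continuous_on_compose2[OF gc] continuous_intros)
          (use TH in \<open>auto simp: T_def\<close>)
      fix p :: "real^('n option)" assume p: "p \<in> cbox 0 1"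
      have "T p = (z + hz p) + (ht (T p) - ht z) *\<^sub>R e"
        unfolding ht_T unfolding T_def e_def hz_def[of z] by (simp add: algebra_simps)
      moreover have "0 \<le> ht (T p) - ht z" using z(3) mult_nonneg_nonneg[OF less_imp_le[OF \<epsilon>(1)[of k]] p0[OF p]] by (simp add: ht_T)
      ultimately have "U (z + hz p) \<le> U (T p)"
        using U_mono[of "z + hz p" "ht (T p) - ht z"] z(1) by (simp add: half_space_add_hz)
      then show "U (z + hz p) - 1 \<le> g (T p)" by (simp add: g_def)
    qed
    moreover have "integral (cbox 0 1) (\<lambda>p. U (z + hz p) - 1) = av U z - 1"
      by (subst integral_diff) (auto intro: av_integrable[OF continuous_on_U z(1)] simp: av_def content_unit_cbox)
    ultimately show "av U z \<le> 1 + \<eta>" by simp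
  qed
qed

definition G1 :: "'n option \<Rightarrow> real^('n option) \<Rightarrow> real" where
  "G1 i z = av (pd i v) z * ht z powr (- a) + (- a * ht z powr (- a - 1) * (if i = None then 1 else 0)) * av v z"

definition G2 :: "'n option \<Rightarrow> real^('n option) \<Rightarrow> real" where
  "G2 i z = av (pd i (pd i v)) z * ht z powr (- a)
     + 2 * (- a * ht z powr (- a - 1) * (if i = None then 1 else 0)) * av (pd i v) z
     + (- a * ((- a - 1) * ht z powr (- a - 2)) * (if i = None then 1 else 0)) * av v z"

lemma DERIV_ht_powr_axis:
  assumes "z \<in> half_space"
  shows "DERIV (\<lambda>t. ht (z + t *\<^sub>R axis i 1) powr c) 0 :> c * ht z powr (c - 1) * (if i = None then 1 else 0)"
  using assms by (auto intro!: derivative_eq_intros simp: half_space_iff powr_diff)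

lemma C1_v: "C1_on half_space v" "C1_on half_space (pd i v)"
  using v_C2 by (auto simp: C2_on_def)

lemma DERIV_G:
  assumes z: "z \<in> half_space"
  shows "DERIV (\<lambda>t. av U (z + t *\<^sub>R axis i 1)) 0 :> G1 i z"
  unfolding av_U_eq
  by (rule DERIV_cong, rule DERIV_mult[OF av_DERIV[OF C1_v(1) z] DERIV_ht_powr_axis[OF z]])
    (simp add: G1_def)

lemma DERIV_G1:
  assumes z: "z \<in> half_space"
  shows "DERIV (\<lambda>t. G1 i (z + t *\<^sub>R axis i 1)) 0 :> G2 i z"
  unfolding G1_def
  by (rule DERIV_cong, (rule DERIV_add DERIV_mult DERIV_const av_DERIV[OF C1_v(1) z] av_DERIV[OF C1_v(2) z] DERIV_ht_powr_axis[OF z])+)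
    (simp add: G2_def algebra_simps)

text \<open>The coefficients of the equation for v depend on the height only, so the equation
  survives horizontal averaging. Passing from v to U = v y^(-a) removes the zero order term.\<close>

lemma av_equation:
  assumes z: "z \<in> half_space"
  shows "(\<Sum>i\<in>UNIV. G2 i z) = (real CARD('n) - 1 - 2 * a) * G1 None z / ht z"
proof -
  define n where "n = real CARD('n)"
  define y where "y = ht z"
  have y: "y > 0" using z by (simp add: y_def half_space_iff)
  have c: "continuous_on half_space (pd i v)" "continuous_on half_space (pd i (pd i v))" for i
    using C1_v by (auto simp: C1_on_def)
  have hi: "((\<lambda>p. pd i v (z + hz p)) has_integral av (pd i v) z) (cbox 0 1)"
    "((\<lambda>p. pd i (pd i v) (z + hz p)) has_integral av (pd i (pd i v)) z) (cbox 0 1)"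
    "((\<lambda>p. v (z + hz p)) has_integral av v z) (cbox 0 1)" for i
    unfolding av_def by (intro integrable_integral av_integrable c continuous_on_v z)+
  have "0 = integral (cbox 0 (1 :: real^('n option))) (\<lambda>p. 0)" by simp
  also have "\<dots> = integral (cbox 0 1) (\<lambda>p. y\<^sup>2 * (\<Sum>i\<in>UNIV. pd i (pd i v) (z + hz p))
      - (n - 1) * y * pd None v (z + hz p) + (n - a) * a * v (z + hz p))"
    using v_eq[of "z + hz p" for p] z by (intro integral_cong) (simp add: half_space_add_hz y_def n_def)
  also have "\<dots> = y\<^sup>2 * (\<Sum>i\<in>UNIV. av (pd i (pd i v)) z) - (n - 1) * y * av (pd None v) z + (n - a) * a * av v z"
    by (intro integral_unique has_integral_add has_integral_diff has_integral_mult_right has_integral_sum hi) simp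
  finally have eq: "y\<^sup>2 * (\<Sum>i\<in>UNIV. av (pd i (pd i v)) z) = (n - 1) * y * av (pd None v) z - (n - a) * a * av v z"
    by simp
  define X where "X = y powr (- a - 2)"
  have p: "y powr (- a) = y\<^sup>2 * X" "y powr (- a - 1) = y * X"
    using y powr_add[of y 2 "- a - 2"] powr_add[of y 1 "- a - 2"]
    by (simp_all add: X_def powr_numeral minus_diff_commute)
  have "(\<Sum>i\<in>UNIV. G2 i z) = X * (y\<^sup>2 * (\<Sum>i\<in>UNIV. av (pd i (pd i v)) z))
     + 2 * (- a * (y * X)) * av (pd None v) z + (- a * ((- a - 1) * X)) * av v z"
  proof -
    have "G2 i z = X * (y\<^sup>2 * av (pd i (pd i v)) z)
     + (if i = None then 2 * (- a * (y * X)) * av (pd None v) z + (- a * ((- a - 1) * X)) * av v z else 0)" for i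
      unfolding G2_def y_def[symmetric] p X_def[symmetric] by simp
    then show ?thesis by (simp add: sum.distrib sum_distrib_left)
  qed
  \<comment> \<open>The coefficient of \<open>av v z\<close> is -(n - a) a + a (a + 1) = - a (n - 1
    - 2 a), which is what makes the common factor appear.\<close>
  also have "\<dots> = (n - 1 - 2 * a) * X * (y * av (pd None v) z - a * av v z)"
    unfolding eq by (simp add: algebra_simps)
  also have "\<dots> = (n - 1 - 2 * a) * G1 None z / y"
    unfolding G1_def y_def[symmetric] p using y by (simp add: field_simps power2_eq_square)
  finally show ?thesis by (simp add: n_def y_def)
qed

text \<open>The function av U - 1 - \<epsilon> h cannot be positive anywhere: growth excludes a
  positive maximum near infinity, \<open>av_U_boundary\<close> together with h \<ge> 0 one near y =
  0, and the strict supersolution property one inside. Then \<epsilon> tends to 0 at a fixed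
  point.\<close>

lemma av_U_le_1:
  assumes z: "z \<in> half_space"
  shows "av U z \<le> 1"
proof -
  define C where "C = - 2 * a"
  have C: "0 < C" "C \<le> 2" using a by (auto simp: C_def)
  define b where "b = (C + 1/4) / 2"
  define m where "m = (C - 3/4) / 2"
  define A where "A = (C + 1/4) / min C (7/16)"
  have A: "A > 0" "A * min C (7/16) = C + 1/4"
    using C by (auto simp: A_def)
  define h where "h = (bar b m A :: real^('n option) \<Rightarrow> real)"
  have h_ge: "norm p powr (C + 1/4) \<le> h p" if "p \<in> half_space" for p
  proof -
    have "norm p powr (C + 1/4) = (p \<bullet> p) powr b"
      unfolding norm_eq_sqrt_inner b_def by (simp add: powr_half_sqrt[symmetric] powr_powr field_simps)
    then show ?thesis
      using that A by (simp add: h_def bar_def half_space_iff)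
  qed
  have h_pos: "h p \<ge> 0" if "p \<in> half_space" for p
    using h_ge[OF that] by (rule order_trans[rotated]) simp
  have h_cont: "continuous_on half_space h"
    unfolding h_def bar_def using half_space_inner_pos
    by (intro continuous_intros) (auto simp: less_imp_neq[THEN not_sym])
  obtain K where K: "K > 0" "\<And>p. p \<in> half_space \<Longrightarrow> av U p \<le> K * (1 + norm p) powr C"
    using av_U_growth unfolding C_def by blast
  have root4: "(Y ^ 4) powr (1/4) = Y" if "Y > 0" for Y :: real
    using that by (simp add: powr_powr flip: powr_numeral)
  have main: "av U z \<le> 1 + \<epsilon> * h z" if \<epsilon>: "\<epsilon> > 0" for \<epsilon>
  proof (rule ccontr)
    define F where "F p = av U p - 1 - \<epsilon> * h p" for p
    assume "\<not> ?thesis"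
    then have Fz: "F z > 0" by (simp add: F_def)
    \<comment> \<open>For r \<ge> 1 one has 1 + r \<le> 2 r, so it suffices that K (2 r)^C \<le>
      \<epsilon> r^(C + 1/4). The fourth power undoes the excess exponent 1/4.\<close>
    define R0 where "R0 = max 1 ((K * 2 powr C / \<epsilon>) ^ 4)"
    have far: "F p < 0" if p: "p \<in> half_space" "norm p \<ge> R0" for p
    proof -
      define r where "r = norm p"
      have r: "r \<ge> 1" "(K * 2 powr C / \<epsilon>) ^ 4 \<le> r" using p by (auto simp: R0_def r_def)
      have "((K * 2 powr C / \<epsilon>) ^ 4) powr (1/4) \<le> r powr (1/4)"
        using r by (intro powr_mono2) auto
      moreover have "((K * 2 powr C / \<epsilon>) ^ 4) powr (1/4) = K * 2 powr C / \<epsilon>"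
        using K \<epsilon> by (intro root4) simp
      ultimately have "K * 2 powr C / \<epsilon> \<le> r powr (1/4)"
        by (simp only:)
      then have "K * 2 powr C \<le> \<epsilon> * r powr (1/4)"
        using \<epsilon> by (simp add: pos_divide_le_eq mult.commute)
      then have "(K * 2 powr C) * r powr C \<le> (\<epsilon> * r powr (1/4)) * r powr C"
        by (intro mult_right_mono) auto
      moreover have "av U p \<le> K * (2 * r) powr C"
        using K(2)[OF p(1)] K(1) C r
        by (elim order_trans) (intro mult_left_mono powr_mono2, auto simp: r_def)
      moreover have "(\<epsilon> * r powr (1/4)) * r powr C = \<epsilon> * r powr (C + 1/4)"
        by (simp add: powr_add)
      moreover have "\<epsilon> * r powr (C + 1/4) \<le> \<epsilon> * h p"
        using h_ge[OF p(1)] \<epsilon> by (simp add: r_def)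
      moreover have "K * (2 * r) powr C = (K * 2 powr C) * r powr C"
        using r by (simp add: powr_mult)
      ultimately show ?thesis unfolding F_def by linarith
    qed
    define R where "R = max R0 (norm z)"
    have R: "R > 0" by (simp add: R_def R0_def)
    obtain y where y: "y > 0" "\<And>p. p \<in> half_space \<Longrightarrow> norm p \<le> R \<Longrightarrow> ht p \<le> y \<Longrightarrow> av U p \<le> 1 + F z / 2"
      using av_U_boundary[OF R, of "F z / 2"] Fz by auto
    \<comment> \<open>Compactness supplies a maximum on \<open>S\<close>. The radius and the minimum
      with \<open>ht z\<close> keep z in \<open>S\<close>; off \<open>S\<close> the function F is
      negative or at most F z / 2, so the maximum over \<open>S\<close> is one over the
      half-space.\<close>
    define S where "S = cball 0 R \<inter> {p :: real^('n option). min y (ht z) \<le> ht p}"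
    have my: "0 < min y (ht z)" using y z by (simp add: half_space_iff)
    have SH: "S \<subseteq> half_space" using my by (auto simp: S_def half_space_iff)
    have "closed {p :: real^('n option). min y (ht z) \<le> ht p}"
      unfolding ht_def by (intro closed_Collect_le continuous_intros)
    then have "compact S" unfolding S_def by (intro compact_Int_closed) auto
    moreover have zS: "z \<in> S" by (simp add: S_def R_def)
    moreover have "continuous_on S F"
      unfolding F_def
      by (intro continuous_intros continuous_on_subset[OF av_continuous_U SH] continuous_on_subset[OF h_cont SH])
    ultimately obtain z0 where z0: "z0 \<in> S" "\<And>p. p \<in> S \<Longrightarrow> F p \<le> F z0"
      using continuous_attains_sup[of S F] by blast
    have z0H: "z0 \<in> half_space" using z0(1) SH by blast
    have Fz0: "F z \<le> F z0" by (rule z0(2)[OF zS])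
    have max: "F p \<le> F z0" if p: "p \<in> half_space" for p
    proof -
      consider "p \<in> S" | "norm p > R" | "norm p \<le> R" "ht p < y"
        by (cases "norm p \<le> R"; cases "ht p < y") (auto simp: S_def min_le_iff_disj)
      then show ?thesis
      proof cases
        case 2
        then have "F p < 0" using far[OF p] by (simp add: R_def)
        then show ?thesis using Fz Fz0 by simp
      next
        case 3
        have "F p \<le> F z / 2" using y(2)[OF p 3(1)] 3(2) mult_nonneg_nonneg[OF less_imp_le[OF \<epsilon>] h_pos[OF p]]
          unfolding F_def[of p] by linarith
        then show ?thesis using Fz Fz0 by simp
      qed (rule z0(2))
    qed
    \<comment> \<open>The 0 is the derivative of the constant 1, kept so that the differentiation
      rules match the term as it stands.\<close>
    define F1 where "F1 i p = G1 i p - 0 - \<epsilon> * bar1 b m A i p" for i p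
    define F2 where "F2 i p = G2 i p - \<epsilon> * bar2 b m A i p" for i p
    have D1: "DERIV (\<lambda>t. F (p + t *\<^sub>R axis i 1)) 0 :> F1 i p" if "p \<in> half_space" for p i
      unfolding F_def F1_def h_def
      by (rule DERIV_diff DERIV_G DERIV_const DERIV_cmult DERIV_bar that)+
    have D2: "DERIV (\<lambda>t. F1 i (p + t *\<^sub>R axis i 1)) 0 :> F2 i p" if "p \<in> half_space" for p i
      unfolding F1_def F2_def diff_0_right
      by (rule DERIV_diff DERIV_G1 DERIV_cmult DERIV_bar1 that)+
    note M = half_space_max_derivatives[where F=F and ?F1.0=F1 and ?F2.0=F2, OF D1 D2 z0H max]
    \<comment> \<open>At z0 the vertical derivatives of av U and \<epsilon> h agree, while the
      Laplacian of av U is at most that of \<epsilon> h. Strictness in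
      \<open>bar_supersolution\<close> then contradicts \<open>av_equation\<close>.\<close>
    have "(\<Sum>i\<in>UNIV. F2 i z0) \<le> 0" by (intro sum_nonpos M(2))
    then have "(\<Sum>i\<in>UNIV. G2 i z0) \<le> \<epsilon> * (\<Sum>i\<in>UNIV. bar2 b m A i z0)"
      by (simp add: F2_def sum_subtractf sum_distrib_left)
    also have "\<dots> < \<epsilon> * ((real CARD('n) - 1 + C) * bar1 b m A None z0 / ht z0)"
      by (rule mult_strict_left_mono[OF bar_supersolution[OF C z0H _ b_def m_def] \<epsilon>]) (simp add: A(2))
    also have "\<dots> = (real CARD('n) - 1 - 2 * a) * (\<epsilon> * bar1 b m A None z0) / ht z0"
      by (simp add: C_def)
    also have "\<epsilon> * bar1 b m A None z0 = G1 None z0"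
      using M(1)[of None] by (simp add: F1_def)
    finally show False using av_equation[OF z0H] by simp
  qed
  show ?thesis
  proof (rule field_le_epsilon)
    fix x :: real assume x: "x > 0"
    have "h z + 1 > 0" using h_pos[OF z] by simp
    then have "av U z \<le> 1 + x / (h z + 1) * h z" using x by (intro main) auto
    also have "x / (h z + 1) * h z \<le> x * 1"
      using x h_pos[OF z] by (simp add: field_simps)
    finally show "av U z \<le> 1 + x" by simp
  qed
qed

text \<open>On the averaging cube U - 1 is continuous and nonnegative, and its integral is at most
  0. It therefore vanishes on the cube, in particular at the corner p = 0, which is z
  itself.\<close>

lemma U_eq_1:
  assumes z: "z \<in> half_space"
  shows "U z = 1"
proof -
  define g where "g p = U (z + hz p) - 1" for p
  have c: "continuous_on (cbox 0 1) g"
    unfolding g_def using z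
    by (intro continuous_intros continuous_on_compose2[OF continuous_on_U]) (auto simp: half_space_add_hz)
  have g0: "g p \<ge> 0" for p
    using U_ge_1[of "z + hz p"] z by (simp add: g_def half_space_add_hz)
  have "integral (cbox 0 1) g = av U z - 1"
    unfolding g_def
    by (subst integral_diff) (auto intro: av_integrable[OF continuous_on_U z] simp: av_def content_unit_cbox)
  moreover have "0 \<le> integral (cbox 0 1) g" by (rule integral_nonneg) (auto intro: integrable_continuous c g0)
  ultimately have "integral (cbox 0 1) g = 0" using av_U_le_1[OF z] by simp
  moreover have "(g has_integral integral (cbox 0 1) g) (cbox 0 1)"
    by (intro integrable_integral integrable_continuous c)
  ultimately have "(g has_integral 0) (cbox 0 1)" by simp
  moreover have "(\<chi> i. 1/2) \<in> box 0 (1 :: real^('n option))" by (simp add: mem_box_cart)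
  then have "box 0 (1 :: real^('n option)) \<noteq> {}" by blast
  ultimately have "g 0 = 0"
    by (intro has_integral_0_cbox_imp_0[OF c]) (auto simp: g0 mem_box_cart)
  then show ?thesis by (simp add: g_def)
qed

lemma v_eq_powr: "z \<in> half_space \<Longrightarrow> v z = ht z powr a"
  using U_eq_1[of z] by (simp add: U_def half_space_iff field_simps)

end

theorem corollary5p11:
  fixes v :: "real^('n::finite option) \<Rightarrow> real"
    and w \<rho> :: "real^('n option) \<Rightarrow> real"
    and gstar :: "'n option metric"
    and n s \<gamma> :: real
  defines "n \<equiv> real CARD('n)"
  defines "w \<equiv> \<lambda>z. 1 - v z / ht z powr (n - s)"
    and "\<rho> \<equiv> \<lambda>z. v z powr (1 / (n - s))"
  defines "gstar \<equiv> \<lambda>z. (\<rho> z)\<^sup>2 *\<^sub>R hyp_metric z"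
  assumes gamma: "n / 2 < \<gamma>" "\<gamma> \<le> n / 2 + 1"
    and s: "s = n / 2 + \<gamma>"
    and v_C2: "C2_on half_space v"
    and v_pos: "\<forall>z\<in>half_space. v z > 0"
    and v_eq: "\<forall>z\<in>half_space. - laplace_beltrami hyp_metric v z - s * (n - s) * v z = 0"
    and w_H10: "w \<in> H10_tilde"
    and scal: "\<forall>z\<in>half_space. scalar_curvature gstar z \<ge> 0"
  shows "(\<forall>z\<in>half_space. v z = ht z powr (n - s)) \<and> (\<forall>z\<in>half_space. gstar z = mat 1)"
proof -
  define a where "a = n - s"
  \<comment> \<open>Here a = n / 2 - \<gamma>, so the two bounds on \<gamma> become the two bounds
    on a.\<close>
  have a: "- 1 \<le> a" "a < 0" and sa: "s = n - a" using gamma s by (auto simp: a_def)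
  interpret flat_solution v a
  proof
    show "z \<in> half_space \<Longrightarrow> (\<Sum>i\<in>UNIV. (qd a v i z)\<^sup>2) \<le> - 2 * a * qd a v None z / ht z" for z
      using v_eq scal v_pos a(2)
      by (intro scalar_curvature_solution[OF v_C2])
        (auto simp: sa n_def gstar_def \<rho>_def)
    show "(ht z)\<^sup>2 * (\<Sum>i\<in>UNIV. pd i (pd i v) z)
      - (real CARD('n) - 1) * ht z * pd None v z + (real CARD('n) - a) * a * v z = 0" if z: "z \<in> half_space" for z
      using bspec[OF v_eq z] laplace_beltrami_hyp[OF z C2_onD(2)[OF v_C2 open_half_space z]]
      by (simp add: sa n_def)
    show "(\<lambda>z. 1 - v z / ht z powr a) \<in> H10_tilde"
      using w_H10 by (simp add: w_def a_def)
  qed (use a v_C2 v_pos in auto)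
  have v: "v z = ht z powr (n - s)" if "z \<in> half_space" for z
    using v_eq_powr[OF that] by (simp add: a_def)
  have "gstar z = mat 1" if "z \<in> half_space" for z
  proof -
    have y: "ht z > 0" using that by (simp add: half_space_def)
    have "\<rho> z = ht z" using v[OF that] a y by (simp add: \<rho>_def powr_powr a_def)
    then show ?thesis using y by (simp add: gstar_def hyp_metric_def)
  qed
  with v show ?thesis by blast
qed

end
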